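(* Let $\rho$ be a state on $\mathcal H_L$ with smallest positive eigenvalue $s\in(0,1]$, and let $\mathcal N:\mathsf L(\mathcal H_C)\to\mathsf L(\mathcal H_C)$ be a completely positive trace-non-increasing (CPTNI) map. Then $$0\le\Delta^{\mathrm{opt}}(\rho,\mathcal N)\le\overline\Delta\big(\varepsilon^{\mathrm{opt}}(\rho,\mathcal N),s\big).$$
   Context: $\mathcal H_L=\mathbb C^{d_L}$ and $\mathcal H_C=\mathbb C^{d_C}$ with $1<d_L\le d_C<\infty$; $\mathsf L(\mathcal H)$ is the space of linear operators on $\mathcal H$. A CPTNI map is a completely positive map with $\sum_jL_j^\dagger L_j\preceq I$ for its Kraus operators $L_j$. For a completely positive map $\Phi$ on $\mathsf L(\mathcal H_L)$ with Kraus operators $F_j$, the entanglement fidelity is $F_{\mathrm e}(\rho,\Phi):=\sum_j|\operatorname{tr}(\rho F_j)|^2$. For an encoder $\mathcal C:\mathsf L(\mathcal H_L)\to\mathsf L(\mathcal H_C)$, $r_{\mathcal C}$ denotes its Choi rank (the minimum number of Kraus operators). Define $$F^{\mathrm{opt}}(\rho,\mathcal N):=\max_{\mathcal C,\mathcal D}F_{\mathrm e}(\rho,\mathcal D\circ\mathcal N\circ\mathcal C),\qquad F^{\mathrm{opt}}_1(\rho,\mathcal N):=\max_{\mathcal C,\mathcal D:\ r_{\mathcal C}\le1}F_{\mathrm e}(\rho,\mathcal D\circ\mathcal N\circ\mathcal C),$$ where $\mathcal C:\mathsf L(\mathcal H_L)\to\mathsf L(\mathcal H_C)$ and $\mathcal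 D:\mathsf L(\mathcal H_C)\to\mathsf L(\mathcal H_L)$ range over CPTNI maps (with the additional constraint $r_{\mathcal C}\le 1$ in the second). Put $\varepsilon^{\mathrm{opt}}(\rho,\mathcal N):=1-F^{\mathrm{opt}}(\rho,\mathcal N)$ and $\Delta^{\mathrm{opt}}(\rho,\mathcal N):=F^{\mathrm{opt}}(\rho,\mathcal N)-F^{\mathrm{opt}}_1(\rho,\mathcal N)$. For $0<s\le1$ and $0\le\varepsilon\le1$, $$\overline\Delta(\varepsilon,s):=\begin{cases}(s^{-1}-1)\,\ell_s(\varepsilon)^2,&0\le\varepsilon\le s,\\(1-\varepsilon)\min\{\varepsilon,1-s\},&s<\varepsilon\le1,\end{cases}\qquad \ell_s(x):=\frac{x}{1+\sqrt{1-x/s}}\quad(0\le x\le s).$$ *)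

theory Defs
  imports "HOL-Analysis.Analysis"
begin

text \<open>
  Operators from \<open>\<complex>\<^sup>n\<close> to \<open>\<complex>\<^sup>m\<close> are matrices of type \<open>complex ^ 'n ^ 'm\<close>;
  maps between operator spaces are plain HOL functions.
\<close>

definition cinner :: "complex ^ 'n \<Rightarrow> complex ^ 'n \<Rightarrow> complex" where
  "cinner v w = (\<Sum>i\<in>UNIV. cnj (v $ i) * w $ i)"

definition dagger :: "complex ^ 'n ^ 'm \<Rightarrow> complex ^ 'm ^ 'n" where
  "dagger A = (\<chi> i j. cnj (A $ j $ i))"

definition cscale :: "complex \<Rightarrow> complex ^ 'n ^ 'm \<Rightarrow> complex ^ 'n ^ 'm" where
  "cscale c A = (\<chi> i j. c * A $ i $ j)"

definition psd :: "complex ^ 'n ^ 'n \<Rightarrow> bool" where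
  "psd A \<longleftrightarrow> (\<forall>v. cinner v (A *v v) \<in> \<real>\<^sub>\<ge>\<^sub>0)"

definition loewner_le :: "complex ^ 'n ^ 'n \<Rightarrow> complex ^ 'n ^ 'n \<Rightarrow> bool" where
  "loewner_le A B \<longleftrightarrow> psd (B - A)"

definition state :: "complex ^ 'n ^ 'n \<Rightarrow> bool" where
  "state \<rho> \<longleftrightarrow> psd \<rho> \<and> trace \<rho> = 1"

definition eigenvalue :: "complex ^ 'n ^ 'n \<Rightarrow> complex \<Rightarrow> bool" where
  "eigenvalue A c \<longleftrightarrow> (\<exists>v. v \<noteq> 0 \<and> A *v v = c *s v)"

definition smallest_pos_eigenvalue :: "complex ^ 'n ^ 'n \<Rightarrow> real \<Rightarrow> bool" where
  "smallest_pos_eigenvalue A s \<longleftrightarrow>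
     0 < s \<and> eigenvalue A (of_real s) \<and>
     (\<forall>t. 0 < t \<and> eigenvalue A (of_real t) \<longrightarrow> s \<le> t)"

definition operator_linear :: "(complex ^ 'n ^ 'n \<Rightarrow> complex ^ 'm ^ 'm) \<Rightarrow> bool" where
  "operator_linear \<Phi> \<longleftrightarrow>
     (\<forall>A B. \<Phi> (A + B) = \<Phi> A + \<Phi> B) \<and> (\<forall>c A. \<Phi> (cscale c A) = cscale c (\<Phi> A))"

text \<open>
  An operator on \<open>\<complex>\<^sup>k \<otimes> \<complex>\<^sup>n\<close> is given by its \<open>k \<times> k\<close> blocks \<open>X i j\<close> with \<open>i, j < k\<close>, and
  \<open>id \<otimes> \<Phi>\<close> acts blockwise. As \<open>k\<close> ranges over all natural numbers, it cannot be a type.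
\<close>

definition block_psd :: "nat \<Rightarrow> (nat \<Rightarrow> nat \<Rightarrow> complex ^ 'n ^ 'n) \<Rightarrow> bool" where
  "block_psd k X \<longleftrightarrow>
     (\<forall>v :: nat \<Rightarrow> complex ^ 'n. (\<Sum>i<k. \<Sum>j<k. cinner (v i) (X i j *v v j)) \<in> \<real>\<^sub>\<ge>\<^sub>0)"

definition completely_positive :: "(complex ^ 'n ^ 'n \<Rightarrow> complex ^ 'm ^ 'm) \<Rightarrow> bool" where
  "completely_positive \<Phi> \<longleftrightarrow>
     operator_linear \<Phi> \<and>
     (\<forall>k X. block_psd k X \<longrightarrow> block_psd k (\<lambda>i j. \<Phi> (X i j)))"

definition kraus ::
  "(complex ^ 'n ^ 'n \<Rightarrow> complex ^ 'm ^ 'm) \<Rightarrow> (complex ^ 'n ^ 'm) list \<Rightarrow> bool" where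
  "kraus \<Phi> Ls \<longleftrightarrow> (\<forall>X. \<Phi> X = (\<Sum>L\<leftarrow>Ls. L ** X ** dagger L))"

text \<open>
  The sum \<open>\<Sum>\<^sub>j L\<^sub>j\<^sup>\<dagger> L\<^sub>j\<close> does not depend on the chosen Kraus operators, so the existential
  quantifier below could equally be a universal one.
\<close>

definition cptni :: "(complex ^ 'n ^ 'n \<Rightarrow> complex ^ 'm ^ 'm) \<Rightarrow> bool" where
  "cptni \<Phi> \<longleftrightarrow>
     completely_positive \<Phi> \<and>
     (\<exists>Ls. kraus \<Phi> Ls \<and> loewner_le (\<Sum>L\<leftarrow>Ls. dagger L ** L) (mat 1))"

definition choi_rank :: "(complex ^ 'n ^ 'n \<Rightarrow> complex ^ 'm ^ 'm) \<Rightarrow> nat" where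
  "choi_rank \<Phi> = (LEAST r. \<exists>Ls. kraus \<Phi> Ls \<and> length Ls = r)"

text \<open>
  The choice of Kraus operators is immaterial; see \<open>ent_fidelity_kraus\<close> below.
\<close>

definition ent_fidelity ::
  "complex ^ 'n ^ 'n \<Rightarrow> (complex ^ 'n ^ 'n \<Rightarrow> complex ^ 'n ^ 'n) \<Rightarrow> real" where
  "ent_fidelity \<rho> \<Phi> = (\<Sum>F\<leftarrow>(SOME Fs. kraus \<Phi> Fs). (cmod (trace (\<rho> ** F)))\<^sup>2)"

lemma trace_sq_conv_kraus:
  fixes \<rho> F :: "complex ^ 'n ^ 'n"
  shows "complex_of_real ((cmod (trace (\<rho> ** F)))\<^sup>2) =
    (\<Sum>a\<in>UNIV. \<Sum>b\<in>UNIV. \<Sum>c\<in>UNIV. \<Sum>d\<in>UNIV. \<rho> $ a $ b * cnj (\<rho> $ c $ d) *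
       (F ** (\<chi> i j. if i = a \<and> j = c then 1 else 0) ** dagger F) $ b $ d)"
proof -
  have unit: "(F ** (\<chi> i j. if i = a \<and> j = c then 1 else 0) ** dagger F) $ b $ d
      = F $ b $ a * cnj (F $ d $ c)" for a b c d
  proof -
    have *: "(\<Sum>k\<in>UNIV. F $ b $ k * (if k = a \<and> j = c then 1 else 0))
        = (if j = c then F $ b $ a else 0)" for j
      by (cases "j = c") (auto simp: if_distrib[of "\<lambda>x. _ * x"] cong: if_cong)
    show ?thesis
      by (simp add: matrix_matrix_mult_def dagger_def *
          if_distrib[of "\<lambda>x. x * _"] cong: if_cong)
  qed
  have "complex_of_real ((cmod (trace (\<rho> ** F)))\<^sup>2) = trace (\<rho> ** F) * cnj (trace (\<rho> ** F))"
    by (rule complex_norm_square)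
  also have "\<dots> = (\<Sum>a\<in>UNIV. \<Sum>b\<in>UNIV. \<rho> $ a $ b * F $ b $ a * cnj (trace (\<rho> ** F)))"
    by (simp add: trace_def matrix_matrix_mult_def sum_distrib_right del: cnj_sum)
  also have "\<dots> = (\<Sum>a\<in>UNIV. \<Sum>b\<in>UNIV. \<Sum>c\<in>UNIV. \<Sum>d\<in>UNIV.
      \<rho> $ a $ b * cnj (\<rho> $ c $ d) * (F $ b $ a * cnj (F $ d $ c)))"
    by (simp add: trace_def matrix_matrix_mult_def sum_distrib_left mult_ac)
  finally show ?thesis by (simp add: unit)
qed

lemma sum_list_matrix_nth:
  "(\<Sum>F\<leftarrow>Fs. (f F :: complex ^ 'n ^ 'm)) $ i $ j = (\<Sum>F\<leftarrow>Fs. f F $ i $ j)"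
  by (induction Fs) auto

lemma ent_fidelity_kraus:
  assumes "kraus \<Phi> Fs"
  shows "ent_fidelity \<rho> \<Phi> = (\<Sum>F\<leftarrow>Fs. (cmod (trace (\<rho> ** F)))\<^sup>2)"
proof -
  define S where "S = (\<Sum>a\<in>UNIV. \<Sum>b\<in>UNIV. \<Sum>c\<in>UNIV. \<Sum>d\<in>UNIV. \<rho> $ a $ b * cnj (\<rho> $ c $ d) *
       \<Phi> (\<chi> i j. if i = a \<and> j = c then 1 else 0) $ b $ d)"
  have main: "complex_of_real (\<Sum>F\<leftarrow>Gs. (cmod (trace (\<rho> ** F)))\<^sup>2) = S"
    if "kraus \<Phi> Gs" for Gs
  proof -
    have "complex_of_real (\<Sum>F\<leftarrow>Gs. (cmod (trace (\<rho> ** F)))\<^sup>2) =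
      (\<Sum>a\<in>UNIV. \<Sum>b\<in>UNIV. \<Sum>c\<in>UNIV. \<Sum>d\<in>UNIV. \<rho> $ a $ b * cnj (\<rho> $ c $ d) *
       (\<Sum>F\<leftarrow>Gs. (F ** (\<chi> i j. if i = a \<and> j = c then 1 else 0) ** dagger F) $ b $ d))"
      by (induction Gs)
        (simp_all add: trace_sq_conv_kraus sum.distrib distrib_left del: of_real_power)
    also have "\<dots> = S"
      using that by (simp add: S_def kraus_def sum_list_matrix_nth)
    finally show ?thesis .
  qed
  have "kraus \<Phi> (SOME Fs. kraus \<Phi> Fs)"
    using assms by (rule someI)
  from main[OF this] main[OF assms] show ?thesis
    unfolding ent_fidelity_def by (metis of_real_eq_iff)
qed

text \<open>
  The suprema below are taken over nonempty sets of reals bounded by \<open>1\<close>, and they are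
  attained (by compactness of the set of CPTNI maps), so they are the maxima.
\<close>

definition F_opt ::
  "complex ^ 'l ^ 'l \<Rightarrow> (complex ^ 'c ^ 'c \<Rightarrow> complex ^ 'c ^ 'c) \<Rightarrow> real" where
  "F_opt \<rho> N = Sup {ent_fidelity \<rho> (D \<circ> N \<circ> C) |
     (C :: complex ^ 'l ^ 'l \<Rightarrow> complex ^ 'c ^ 'c) (D :: complex ^ 'c ^ 'c \<Rightarrow> complex ^ 'l ^ 'l).
     cptni C \<and> cptni D}"

definition F_opt1 ::
  "complex ^ 'l ^ 'l \<Rightarrow> (complex ^ 'c ^ 'c \<Rightarrow> complex ^ 'c ^ 'c) \<Rightarrow> real" where
  "F_opt1 \<rho> N = Sup {ent_fidelity \<rho> (D \<circ> N \<circ> C) |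
     (C :: complex ^ 'l ^ 'l \<Rightarrow> complex ^ 'c ^ 'c) (D :: complex ^ 'c ^ 'c \<Rightarrow> complex ^ 'l ^ 'l).
     cptni C \<and> cptni D \<and> choi_rank C \<le> 1}"

definition eps_opt ::
  "complex ^ 'l ^ 'l \<Rightarrow> (complex ^ 'c ^ 'c \<Rightarrow> complex ^ 'c ^ 'c) \<Rightarrow> real" where
  "eps_opt \<rho> N = 1 - F_opt \<rho> N"

definition Delta_opt ::
  "complex ^ 'l ^ 'l \<Rightarrow> (complex ^ 'c ^ 'c \<Rightarrow> complex ^ 'c ^ 'c) \<Rightarrow> real" where
  "Delta_opt \<rho> N = F_opt \<rho> N - F_opt1 \<rho> N"

definition ell :: "real \<Rightarrow> real \<Rightarrow> real" where
  "ell s x = x / (1 + sqrt (1 - x / s))"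

text \<open>Meaningful for \<open>0 < s \<le> 1\<close> and \<open>0 \<le> \<epsilon> \<le> 1\<close> only.\<close>

definition Delta_bar :: "real \<Rightarrow> real \<Rightarrow> real" where
  "Delta_bar \<epsilon> s =
     (if \<epsilon> \<le> s then (1 / s - 1) * (ell s \<epsilon>)\<^sup>2 else (1 - \<epsilon>) * min \<epsilon> (1 - s))"

end

theory Submission
  imports Defs
begin

text \<open>
  Fix a code with fidelity \<open>g\<close>, write \<open>M\<^sub>m\<close> for the Kraus operators of the noise followed by the
  decoder, \<open>C\<^sub>k\<close> for those of the encoder, and \<open>f K = \<Sum>\<^sub>m |tr (\<rho> M\<^sub>m K)|\<^sup>2\<close>, so that
  \<open>g = \<Sum>\<^sub>k f C\<^sub>k\<close>. As the weights \<open>a\<^sub>k = tr (\<rho> C\<^sub>k\<^sup>\<dagger> C\<^sub>k)\<close> sum to at most \<open>1\<close>, some \<open>C = C\<^sub>k\<close> has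
  \<open>f C \<ge> g a\<^sub>k\<close>. Rescaling \<open>C\<close>, restricted to the support of \<open>\<rho>\<close>, by \<open>(s / a\<^sub>k)\<^sup>1\<^sup>/\<^sup>2\<close> gives a
  contraction of fidelity at least \<open>s g\<close>.

  A unit combination \<open>M\<close> of the \<open>M\<^sub>m\<close> satisfies \<open>f C = |tr (\<rho> M C)|\<^sup>2\<close>, whence
  \<open>g \<le> tr (\<rho> M M\<^sup>\<dagger>)\<close> by Cauchy--Schwarz. The partial isometry \<open>K\<close> of the polar decomposition of
  \<open>M\<^sup>\<dagger>\<close> is an encoder with \<open>tr (\<rho> M K) = tr (\<rho> |M\<^sup>\<dagger>|) =: 1 - x\<close>, and in an eigenbasis of \<open>M M\<^sup>\<dagger>\<close> the
  spectral gap of \<open>\<rho>\<close> gives \<open>tr (\<rho> M M\<^sup>\<dagger>) \<le> 1 - 2 x + x\<^sup>2 / s\<close>. The number \<open>\<ell>\<^sub>s(\<epsilon>)\<close> is the smaller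
  root of \<open>2 x - x\<^sup>2 / s = \<epsilon>\<close>, so the rank-one optimum is at least \<open>(1 - \<ell>\<^sub>s(\<epsilon>))\<^sup>2\<close> for \<open>\<epsilon> \<le> s\<close>.
\<close>

section \<open>Spectral theorem\<close>

lemma cinner_add_right: "cinner v (w + z) = cinner v w + cinner v z"
  by (simp add: cinner_def distrib_left sum.distrib)

lemma cinner_scale_right: "cinner v (c *s w) = c * cinner v w"
  by (simp add: cinner_def sum_distrib_left mult_ac)

lemma cnj_cinner: "cnj (cinner v w) = cinner w v"
  by (simp add: cinner_def mult_ac)

lemma cinner_add_left: "cinner (v + w) z = cinner v z + cinner w z"
  by (simp add: cinner_def distrib_right sum.distrib)

lemma cinner_scale_left: "cinner (c *s v) w = cnj c * cinner v w"
  by (simp add: cinner_def sum_distrib_left mult_ac)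

lemma cinner_zero [simp]: "cinner v 0 = 0" "cinner 0 v = 0"
  by (simp_all add: cinner_def)

lemma cinner_diff_right: "cinner v (w - z) = cinner v w - cinner v z"
  by (simp add: cinner_def right_diff_distrib sum_subtractf)

lemma cinner_diff_left: "cinner (v - w) z = cinner v z - cinner w z"
  by (simp add: cinner_def left_diff_distrib sum_subtractf)

lemma cinner_sum_right: "cinner v (\<Sum>i\<in>I. f i) = (\<Sum>i\<in>I. cinner v (f i))"
  by (induction I rule: infinite_finite_induct) (simp_all add: cinner_add_right)

lemma cinner_self: "cinner v v = of_real ((norm v)\<^sup>2)"
proof -
  have "cinner v v = (\<Sum>i\<in>UNIV. of_real ((cmod (v $ i))\<^sup>2))"
    by (simp add: cinner_def complex_norm_square mult.commute del: of_real_power)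
  also have "\<dots> = of_real ((norm v)\<^sup>2)"
    by (simp add: norm_vec_def L2_set_def sum_nonneg)
  finally show ?thesis .
qed

lemma cmod_cinner_le: "cmod (cinner v w) \<le> norm v * norm w"
proof -
  have "cmod (cinner v w) \<le> (\<Sum>i\<in>UNIV. \<bar>cmod (v $ i)\<bar> * \<bar>cmod (w $ i)\<bar>)"
    unfolding cinner_def by (rule sum_norm_le) (simp add: norm_mult)
  also have "\<dots> \<le> norm v * norm w"
    unfolding norm_vec_def by (rule L2_set_mult_ineq)
  finally show ?thesis .
qed

lemma norm_vector_scale: "norm (c *s v) = cmod c * norm (v :: complex ^ 'n)"
  by (simp add: norm_vec_def norm_mult L2_set_right_distrib)

lemma cinner_matrix_right: "cinner v (A *v w) = cinner (dagger A *v v) w"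
  unfolding cinner_def dagger_def matrix_vector_mult_def
  by (simp add: sum_distrib_left sum_distrib_right mult_ac) (subst sum.swap, rule refl)

lemma dagger_dagger [simp]: "dagger (dagger A) = A"
  by (simp add: dagger_def vec_eq_iff)

lemma dagger_mult: "dagger (A ** B) = dagger B ** dagger A"
  by (simp add: dagger_def matrix_matrix_mult_def vec_eq_iff mult.commute)

lemma cinner_dagger_mult: "cinner v ((dagger A ** A) *v v) = of_real ((norm (A *v v))\<^sup>2)"
  by (simp add: matrix_vector_mul_assoc[symmetric] cinner_matrix_right cinner_self del: of_real_power)

lemma matrix_vector_mult_sum_right: "A *v (\<Sum>i\<in>I. f i) = (\<Sum>i\<in>I. A *v f i)"
  by (induction I rule: infinite_finite_induct) (simp_all add: matrix_vector_right_distrib)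

lemma continuous_on_cinner [continuous_intros]:
  "continuous_on S f \<Longrightarrow> continuous_on S g \<Longrightarrow> continuous_on S (\<lambda>x. cinner (f x) (g x))"
  unfolding cinner_def by (intro continuous_intros)

lemma continuous_on_matrix_vector [continuous_intros]:
  fixes A :: "complex ^ 'n ^ 'm"
  assumes "continuous_on S f"
  shows "continuous_on S (\<lambda>x. A *v f x)"
  unfolding matrix_vector_mult_def using assms by (intro continuous_intros)

text \<open>The quadratic form of the operator sum at \<open>v\<close> is the sum of the squared
  norms of the vectors \<open>L *v v\<close>. This turns the trace condition into an estimate on
  vectors, the only form used from here on.\<close>

lemma loewner_le_one_iff:
  fixes Ls :: "(complex ^ 'n ^ 'm) list"
  shows "loewner_le (\<Sum>L\<leftarrow>Ls. dagger L ** L) (mat 1) \<longleftrightarrow>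
    (\<forall>v. (\<Sum>L\<leftarrow>Ls. (norm (L *v v))\<^sup>2) \<le> (norm v)\<^sup>2)"
proof -
  have *: "cinner v ((\<Sum>L\<leftarrow>Ls. dagger L ** L) *v v) = of_real (\<Sum>L\<leftarrow>Ls. (norm (L *v v))\<^sup>2)" for v
    by (induction Ls) (simp_all add: matrix_vector_mult_add_rdistrib cinner_add_right cinner_dagger_mult)
  have "cinner v ((mat 1 - (\<Sum>L\<leftarrow>Ls. dagger L ** L)) *v v) =
      of_real ((norm v)\<^sup>2 - (\<Sum>L\<leftarrow>Ls. (norm (L *v v))\<^sup>2))" for v
    by (simp add: matrix_vector_mult_diff_rdistrib cinner_diff_right * cinner_self)
  then show ?thesis
    by (simp add: loewner_le_def psd_def del: of_real_diff)
qed

section \<open>Self-adjoint operators and orthonormal bases\<close>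

definition selfadjoint :: "complex ^ 'n ^ 'n \<Rightarrow> bool" where
  "selfadjoint A \<longleftrightarrow> (\<forall>v w. cinner v (A *v w) = cinner (A *v v) w)"

text \<open>Polarisation: a real quadratic form at \<open>v + w\<close> relates the imaginary parts
  of the two mixed terms, and at \<open>v + \<i> *s w\<close> their real parts, so that the mixed
  terms are conjugate.\<close>

lemma psd_imp_selfadjoint:
  assumes "psd A"
  shows "selfadjoint A"
  unfolding selfadjoint_def
proof (intro allI)
  fix v w
  define q where "q z = cinner z (A *v z)" for z
  have im: "Im (q z) = 0" for z
    using assms by (auto simp: psd_def q_def complex_nonneg_Reals_iff)
  have 1: "q (v + w) = q v + q w + cinner v (A *v w) + cinner w (A *v v)"
    by (simp add: q_def matrix_vector_right_distrib cinner_add_right cinner_add_left)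
  have 2: "q (v + \<i> *s w) = q v + q w + \<i> * cinner v (A *v w) - \<i> * cinner w (A *v v)"
    by (simp add: q_def matrix_vector_right_distrib cinner_add_right cinner_add_left
      vector_scalar_commute cinner_scale_left cinner_scale_right algebra_simps)
  have "cinner v (A *v w) = cnj (cinner w (A *v v))"
    using im[of "v + w"] im[of "v + \<i> *s w"] im[of v] im[of w] unfolding 1 2
    by (simp add: complex_eq_iff)
  then show "cinner v (A *v w) = cinner (A *v v) w"
    by (simp add: cnj_cinner)
qed

text \<open>The index type is that of the coordinates, so the family has as many members as the
  dimension and orthonormality alone makes it a basis.\<close>

definition onb :: "('n \<Rightarrow> complex ^ 'n) \<Rightarrow> bool" where
  "onb e \<longleftrightarrow> (\<forall>i j. cinner (e i) (e j) = (if i = j then 1 else 0))"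

lemma onb_norm: "onb e \<Longrightarrow> norm (e i) = 1"
proof -
  assume "onb e"
  then have "complex_of_real ((norm (e i))\<^sup>2) = of_real 1"
    unfolding cinner_self[symmetric] by (simp add: onb_def)
  then have "(norm (e i))\<^sup>2 = 1\<^sup>2" by (simp only: of_real_eq_iff power_one)
  then show ?thesis by (rule power2_eq_imp_eq) simp_all
qed

text \<open>Completeness relation: the matrix with columns \<open>e k\<close> has its adjoint as
  left inverse, hence also as right inverse, because it is square.\<close>

lemma onb_entries:
  fixes e :: "'n::finite \<Rightarrow> complex ^ 'n"
  assumes "onb e"
  shows "(\<Sum>k\<in>UNIV. e k $ i * cnj (e k $ j)) = (if i = j then 1 else 0)"
proof -
  define U :: "complex ^ 'n ^ 'n" where "U = (\<chi> i j. e j $ i)"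
  have "dagger U ** U = mat 1"
    using assms by (simp add: U_def dagger_def matrix_matrix_mult_def vec_eq_iff mat_def onb_def cinner_def)
  then have "U ** dagger U = mat 1"
    by (simp add: matrix_left_right_inverse)
  then show ?thesis
    by (simp add: U_def dagger_def matrix_matrix_mult_def vec_eq_iff mat_def)
qed

lemma onb_expand:
  assumes "onb e"
  shows "v = (\<Sum>i\<in>UNIV. cinner (e i) v *s e i)"
proof -
  have "(\<Sum>i\<in>UNIV. cinner (e i) v *s e i) $ k = v $ k" for k
  proof -
    have "(\<Sum>i\<in>UNIV. cinner (e i) v *s e i) $ k = (\<Sum>i\<in>UNIV. \<Sum>l\<in>UNIV. v $ l * (e i $ k * cnj (e i $ l)))"
      by (simp add: cinner_def sum_distrib_left sum_distrib_right mult_ac)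
    also have "\<dots> = (\<Sum>l\<in>UNIV. v $ l * (\<Sum>i\<in>UNIV. e i $ k * cnj (e i $ l)))"
      by (subst sum.swap) (simp add: sum_distrib_left)
    also have "\<dots> = v $ k"
      by (simp add: onb_entries[OF assms] if_distrib[of "\<lambda>x. _ * x"] cong: if_cong)
    finally show ?thesis .
  qed
  then show ?thesis by (simp add: vec_eq_iff)
qed

lemma onb_cinner_sum:
  fixes v w :: "complex ^ 'n"
  assumes "onb e"
  shows "cinner v w = (\<Sum>i\<in>UNIV. cinner v (e i) * cinner (e i) w)"
proof -
  have "cinner v w = cinner v (\<Sum>i\<in>UNIV. cinner (e i) w *s e i)"
    using onb_expand[OF assms, of w] by simp
  then show ?thesis by (simp add: cinner_sum_right cinner_scale_right mult.commute)
qed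

lemma onb_parseval:
  assumes "onb e"
  shows "(norm v)\<^sup>2 = (\<Sum>i\<in>UNIV. (cmod (cinner (e i) v))\<^sup>2)"
proof -
  have "complex_of_real ((norm v)\<^sup>2) = cinner v v"
    by (rule cinner_self[symmetric])
  also have "\<dots> = (\<Sum>i\<in>UNIV. cinner v (e i) * cinner (e i) v)"
    by (rule onb_cinner_sum[OF assms])
  also have "\<dots> = (\<Sum>i\<in>UNIV. of_real ((cmod (cinner (e i) v))\<^sup>2))"
    by (intro sum.cong refl) (metis cnj_cinner complex_norm_square mult.commute)
  also have "\<dots> = of_real (\<Sum>i\<in>UNIV. (cmod (cinner (e i) v))\<^sup>2)"
    by (rule of_real_sum[symmetric])
  finally show ?thesis by (simp only: of_real_eq_iff)
qed

lemma onb_trace: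
  assumes "onb e"
  shows "trace A = (\<Sum>i\<in>UNIV. cinner (e i) (A *v e i))"
proof -
  have "(\<Sum>i\<in>UNIV. cinner (e i) (A *v e i)) =
      (\<Sum>i\<in>UNIV. \<Sum>j\<in>UNIV. \<Sum>k\<in>UNIV. A $ j $ k * (e i $ k * cnj (e i $ j)))"
    by (simp add: cinner_def matrix_vector_mult_def sum_distrib_left mult_ac)
  also have "\<dots> = (\<Sum>j\<in>UNIV. \<Sum>k\<in>UNIV. \<Sum>i\<in>UNIV. A $ j $ k * (e i $ k * cnj (e i $ j)))"
    by (subst sum.swap, rule sum.cong[OF refl], rule sum.swap)
  also have "\<dots> = (\<Sum>j\<in>UNIV. \<Sum>k\<in>UNIV. A $ j $ k * (if k = j then 1 else 0))"
    by (simp only: sum_distrib_left[symmetric] onb_entries[OF assms])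
  also have "\<dots> = trace A"
    by (simp add: trace_def if_distrib[of "\<lambda>x. _ * x"] cong: if_cong)
  finally show ?thesis ..
qed

lemma onb_matrix_eqI:
  fixes A B :: "complex ^ 'n ^ 'm"
  assumes "onb e" and "\<And>i. A *v e i = B *v e i"
  shows "A = B"
proof -
  have "A *v v = B *v v" for v
  proof -
    have "A *v v = (\<Sum>i\<in>UNIV. cinner (e i) v *s (A *v e i))" for A :: "complex ^ 'n ^ 'm"
      by (subst onb_expand[OF assms(1), of v])
        (simp add: vector_scalar_commute matrix_vector_mult_sum_right)
    then show ?thesis using assms(2) by simp
  qed
  then show ?thesis by (simp add: matrix_eq)
qed

section \<open>Variational construction of an eigenbasis\<close>

lemma quadratic_nonneg_imp_linear_zero:
  fixes b c :: real
  assumes "\<And>t. 0 \<le> b * t + c * t\<^sup>2"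
  shows "b = 0"
proof (rule ccontr)
  assume b: "b \<noteq> 0"
  define d where "d = \<bar>c\<bar> + 1"
  \<comment> \<open>With this \<open>t\<close> the expression equals
    \<open>(c - d) * t\<^sup>2\<close>, which is negative because \<open>c < d\<close>.\<close>
  define t where "t = - b / d"
  have d: "0 < d" "c < d" by (simp_all add: d_def)
  then have "b = - d * t" by (simp add: t_def)
  then have "b * t = - d * t\<^sup>2" by (simp add: power2_eq_square)
  then have "0 \<le> (c - d) * t\<^sup>2" using assms[of t] by (simp add: algebra_simps)
  moreover have "0 < t\<^sup>2" using b d by (simp add: t_def)
  ultimately show False using d by (simp add: zero_le_mult_iff)
qed

text \<open>Orthogonality to the \<open>e j\<close> is a square linear system once it is padded with
  zero rows outside \<open>J\<close>. Row \<open>k\<close> vanishes, so the determinant does too and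
  the kernel is nontrivial.\<close>

lemma exists_orthogonal_unit_vector:
  fixes e :: "'n::finite \<Rightarrow> complex ^ 'n"
  assumes "k \<notin> J"
  obtains v where "norm v = 1" and "\<And>j. j \<in> J \<Longrightarrow> cinner (e j) v = 0"
proof -
  define B :: "complex ^ 'n ^ 'n" where "B = (\<chi> i l. if i \<in> J then cnj (e i $ l) else 0)"
  have "det B = 0"
    by (rule det_zero_row(1)[of k]) (use assms in \<open>simp add: B_def row_def vec_eq_iff\<close>)
  then have "\<not> (\<exists>C. C ** B = mat 1)"
    by (metis invertible_det_nz invertible_left_inverse)
  then obtain v where v: "B *v v = 0" "v \<noteq> 0"
    by (auto simp: matrix_left_invertible_ker)
  have "cinner (e j) v = 0" if "j \<in> J" for j
  proof -
    have "(B *v v) $ j = 0" by (simp add: v)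
    then show ?thesis using that by (simp add: B_def matrix_vector_mult_def cinner_def)
  qed
  then show ?thesis
    using v by (intro that[of "of_real (1 / norm v) *s v"])
      (simp_all add: norm_vector_scale cinner_scale_right norm_divide)
qed

text \<open>The orthogonal complement \<open>W\<close> of the eigenvectors found so far is invariant
  under \<open>A\<close>. A maximiser of the quadratic form on its unit sphere exists by
  compactness, and the first-order condition makes it an eigenvector.\<close>

lemma spectral_step:
  fixes A :: "complex ^ 'n ^ 'n" and e :: "'n \<Rightarrow> complex ^ 'n"
  assumes A: "selfadjoint A" and k: "k \<notin> J"
    and eig: "\<And>j. j \<in> J \<Longrightarrow> A *v e j = of_real (c j) *s e j"
  obtains v r where "norm v = 1" and "\<And>j. j \<in> J \<Longrightarrow> cinner (e j) v = 0"
    and "A *v v = of_real r *s v"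
proof -
  define W where "W = {v. \<forall>j\<in>J. cinner (e j) v = 0}"
  define S where "S = sphere 0 1 \<inter> W"
  define q where "q v = Re (cinner v (A *v v))" for v
  have "closed {v. cinner (e j) v = 0}" for j
    by (intro closed_Collect_eq continuous_intros)
  moreover have "W = (\<Inter>j\<in>J. {v. cinner (e j) v = 0})" by (auto simp: W_def)
  ultimately have "closed W" by auto
  then have "compact S" unfolding S_def by (rule compact_Int_closed[OF compact_sphere])
  moreover have "S \<noteq> {}"
  proof -
    obtain v where "norm v = 1" "\<And>j. j \<in> J \<Longrightarrow> cinner (e j) v = 0"
      by (rule exists_orthogonal_unit_vector[OF k, of e]) (rule that)
    then have "v \<in> S" by (simp add: S_def W_def)
    then show ?thesis by blast
  qed
  moreover have "continuous_on S q"
    unfolding q_def by (intro continuous_intros)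
  ultimately obtain v where v: "v \<in> S" and max: "\<And>w. w \<in> S \<Longrightarrow> q w \<le> q v"
    using continuous_attains_sup[of S q] by blast
  have nv: "norm v = 1" and vW: "v \<in> W" using v by (auto simp: S_def)
  define r where "r = q v"
  \<comment> \<open>By maximality, \<open>B\<close> has a nonnegative quadratic form on
    \<open>W\<close>, which vanishes at \<open>v\<close>; the aim is \<open>B v = 0\<close>.\<close>
  define B where "B w = of_real r *s w - A *v w" for w
  have BW: "B w \<in> W" if "w \<in> W" for w
  proof -
    have "cinner (e j) (A *v w) = 0" if "j \<in> J" for j
    proof -
      have "cinner (e j) (A *v w) = cinner (A *v e j) w"
        using A by (simp add: selfadjoint_def)
      then show ?thesis using \<open>w \<in> W\<close> that by (simp add: eig W_def cinner_scale_left)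
    qed
    then show ?thesis using that
      by (simp add: B_def W_def cinner_diff_right cinner_scale_right)
  qed
  have B_add: "B (w + z) = B w + B z" for w z
    by (simp add: B_def matrix_vector_right_distrib vector_add_ldistrib)
  have B_scale: "B (a *s w) = a *s B w" for a w
    by (simp add: B_def vector_scalar_commute vector_ssub_ldistrib mult.commute)
  have B_adj: "cinner w (B z) = cinner (B w) z" for w z
  proof -
    have "cinner (B w) z = cnj (cinner z (B w))" by (simp add: cnj_cinner)
    also have "\<dots> = of_real r * cinner w z - cinner (A *v w) z"
      by (simp add: B_def cinner_diff_right cinner_scale_right cnj_cinner)
    also have "\<dots> = cinner w (B z)"
      using A by (simp add: B_def cinner_diff_right cinner_scale_right selfadjoint_def)
    finally show ?thesis ..
  qed
  have Bq: "Re (cinner w (B w)) = r * (norm w)\<^sup>2 - q w" for w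
    by (simp add: B_def cinner_diff_right cinner_scale_right cinner_self q_def flip: of_real_power)
  have B_nonneg: "0 \<le> Re (cinner w (B w))" if w: "w \<in> W" for w
  proof (cases "w = 0")
    case False
    define u where "u = of_real (1 / norm w) *s w"
    have "u \<in> S" using False w
      by (simp add: u_def S_def W_def norm_vector_scale norm_divide cinner_scale_right)
    have "norm w > 0" using False by simp
    have "q u = q w / (norm w)\<^sup>2"
      by (simp add: q_def u_def vector_scalar_commute cinner_scale_left cinner_scale_right power2_eq_square
        del: of_real_divide)
    then have "q w / (norm w)\<^sup>2 \<le> r" using max[OF \<open>u \<in> S\<close>] by (simp add: r_def)
    then show ?thesis using \<open>norm w > 0\<close> by (simp add: Bq pos_divide_le_eq)
  qed simp
  \<comment> \<open>Perturb \<open>v\<close> in the direction \<open>B v\<close>, which stays in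
    \<open>W\<close>. The quadratic form of \<open>B\<close> along this line has no constant term,
    so nonnegativity kills its linear coefficient.\<close>
  have "(norm (B v))\<^sup>2 * 2 = 0"
  proof (rule quadratic_nonneg_imp_linear_zero)
    fix t :: real
    define z where "z = B v"
    have zW: "z \<in> W" using BW[OF vW] by (simp add: z_def)
    have "v + of_real t *s z \<in> W"
      using vW zW by (simp add: W_def cinner_add_right cinner_scale_right)
    then have "0 \<le> Re (cinner (v + of_real t *s z) (B (v + of_real t *s z)))"
      by (rule B_nonneg)
    also have "cinner (v + of_real t *s z) (B (v + of_real t *s z)) =
      cinner v (B v) + of_real t * (cinner v (B z) + cinner z (B v)) + of_real (t\<^sup>2) * cinner z (B z)"
      by (simp add: B_add B_scale cinner_add_left cinner_add_right cinner_scale_left cinner_scale_right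
        algebra_simps power2_eq_square)
    also have "cinner v (B z) + cinner z (B v) = of_real (2 * (norm (B v))\<^sup>2)"
      by (simp add: B_adj[of v] z_def[symmetric] cinner_self)
    finally show "0 \<le> (norm (B v))\<^sup>2 * 2 * t + Re (cinner z (B z)) * t\<^sup>2"
      using Bq[of v] by (simp add: nv r_def mult_ac del: of_real_power)
  qed
  then have "A *v v = of_real r *s v" by (simp add: B_def)
  with nv vW show ?thesis by (intro that) (auto simp: W_def)
qed

theorem spectral_theorem:
  fixes A :: "complex ^ 'n ^ 'n"
  assumes "selfadjoint A"
  obtains e :: "'n \<Rightarrow> complex ^ 'n" and c :: "'n \<Rightarrow> real"
  where "onb e" and "\<And>i. A *v e i = of_real (c i) *s e i"
proof -
  \<comment> \<open>Induction over the index set: partial families indexed by \<open>J\<close> are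
    extended by one eigenvector at a time, until \<open>J\<close> is the whole type.\<close>
  have "\<exists>e c. (\<forall>i\<in>J. \<forall>j\<in>J. cinner (e i) (e j) = (if i = j then 1 else 0)) \<and>
      (\<forall>i\<in>J. A *v e i = of_real (c i :: real) *s e i)" for J :: "'n set"
  proof (induction J rule: finite_induct[OF finite])
    case (2 k J)
    then obtain e c where e: "\<And>i j. i \<in> J \<Longrightarrow> j \<in> J \<Longrightarrow> cinner (e i) (e j) = (if i = j then 1 else 0)"
      and c: "\<And>i. i \<in> J \<Longrightarrow> A *v e i = of_real (c i :: real) *s e i" by metis
    from spectral_step[of A k J e c, OF assms \<open>k \<notin> J\<close> c] obtain v r where nv: "norm v = 1"
      and v: "\<And>j. j \<in> J \<Longrightarrow> cinner (e j) v = 0" and Av: "A *v v = of_real r *s v" by metis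
    have v': "cinner v (e j) = 0" if "j \<in> J" for j
      using v[OF that] by (metis cnj_cinner complex_cnj_zero)
    have "cinner v v = 1" by (simp add: cinner_self nv)
    then show ?case using \<open>k \<notin> J\<close> e c v v' Av
      by (intro exI[of _ "e(k := v)"] exI[of _ "c(k := r)"]) auto
  qed auto
  from this[of UNIV] show ?thesis using that by (auto simp: onb_def)
qed

section \<open>Operators with prescribed eigenbasis and real eigenvalues, serving as functional
  calculus; contractions\<close>

definition spectral_matrix :: "('n \<Rightarrow> complex ^ 'n) \<Rightarrow> ('n \<Rightarrow> real) \<Rightarrow> complex ^ 'n ^ 'n" where
  "spectral_matrix e d = (\<chi> i j. \<Sum>k\<in>UNIV. of_real (d k) * e k $ i * cnj (e k $ j))"

lemma spectral_matrix_mult: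
  "spectral_matrix e d *v v = (\<Sum>k\<in>UNIV. (of_real (d k) * cinner (e k) v) *s e k)"
proof -
  have "(\<Sum>j\<in>UNIV. \<Sum>k\<in>UNIV. v $ j * (of_real (d k) * (e k $ i * cnj (e k $ j)))) =
    (\<Sum>k\<in>UNIV. \<Sum>j\<in>UNIV. v $ j * (of_real (d k) * (e k $ i * cnj (e k $ j))))" for i
    by (rule sum.swap)
  then show ?thesis
    by (simp add: vec_eq_iff spectral_matrix_def matrix_vector_mult_def cinner_def
      sum_distrib_left sum_distrib_right mult_ac)
qed

lemma spectral_matrix_eigen:
  fixes e :: "'n::finite \<Rightarrow> complex ^ 'n"
  assumes "onb e"
  shows "spectral_matrix e d *v e i = of_real (d i) *s e i"
proof -
  have "spectral_matrix e d *v e i = (\<Sum>k\<in>UNIV. if k = i then of_real (d i) *s e i else 0)"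
    unfolding spectral_matrix_mult using assms by (intro sum.cong) (auto simp: onb_def)
  then show ?thesis by simp
qed

lemma dagger_spectral_matrix: "dagger (spectral_matrix e d) = spectral_matrix e d"
  by (simp add: dagger_def spectral_matrix_def vec_eq_iff mult_ac)

lemma cinner_spectral_matrix:
  assumes "onb e"
  shows "cinner (e i) (spectral_matrix e d *v v) = of_real (d i) * cinner (e i) v"
  by (simp add: cinner_matrix_right dagger_spectral_matrix spectral_matrix_eigen[OF assms] cinner_scale_left)

lemma selfadjoint_iff_dagger: "selfadjoint A \<longleftrightarrow> dagger A = A"
proof
  assume *: "selfadjoint A"
  have "cinner (dagger A *v v - A *v v) w = 0" for v w
    using * cinner_matrix_right[of v A w] unfolding cinner_diff_left selfadjoint_def by simp
  from this[of v "dagger A *v v - A *v v" for v] have "dagger A *v v - A *v v = 0" for v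
    by (simp add: cinner_self)
  then show "dagger A = A" by (simp add: matrix_eq)
qed (simp add: selfadjoint_def cinner_matrix_right)

definition contractive :: "complex ^ 'n ^ 'm \<Rightarrow> bool" where
  "contractive A \<longleftrightarrow> (\<forall>v. norm (A *v v) \<le> norm v)"

text \<open>The squared norm of \<open>dagger A *v v\<close> is the inner product of
  \<open>v\<close> with \<open>A *v (dagger A *v v)\<close>; Cauchy-Schwarz leaves a factor to
  cancel.\<close>

lemma contractive_dagger:
  assumes "contractive A"
  shows "contractive (dagger A)"
  unfolding contractive_def
proof
  fix v
  have "(norm (dagger A *v v))\<^sup>2 = cmod (cinner v (A *v (dagger A *v v)))"
    by (simp add: cinner_matrix_right cinner_self norm_power)
  also have "\<dots> \<le> norm v * norm (A *v (dagger A *v v))" by (rule cmod_cinner_le)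
  also have "\<dots> \<le> norm v * norm (dagger A *v v)"
    using assms by (simp add: contractive_def mult_left_mono)
  finally show "norm (dagger A *v v) \<le> norm v"
    by (cases "norm (dagger A *v v) = 0") (auto simp: power2_eq_square)
qed

lemma dagger_add: "dagger (A + B) = dagger A + dagger B"
  by (simp add: dagger_def vec_eq_iff)

section \<open>Scalar inequalities for second moments\<close>

lemma sum_squares_le_square_sum:
  fixes z :: "'a \<Rightarrow> real"
  assumes "finite I" "\<And>i. i \<in> I \<Longrightarrow> 0 \<le> z i"
  shows "(\<Sum>i\<in>I. (z i)\<^sup>2) \<le> (\<Sum>i\<in>I. z i)\<^sup>2"
proof -
  have "(\<Sum>i\<in>I. (z i)\<^sup>2) \<le> (\<Sum>i\<in>I. z i * (\<Sum>j\<in>I. z j))"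
    unfolding power2_eq_square using assms by (intro sum_mono mult_left_mono member_le_sum) auto
  then show ?thesis by (simp add: power2_eq_square sum_distrib_right)
qed

text \<open>For \<open>y i = 1 - sqrt (a i)\<close> the mean is \<open>x\<close> and
  \<open>a i = 1 - 2 * y i + (y i)\<^sup>2\<close>. A nonzero weight is at least \<open>s\<close>,
  so \<open>r i * (y i)\<^sup>2\<close> is at most \<open>(r i * y i)\<^sup>2 / s\<close>, and these
  squares sum to at most \<open>x\<^sup>2 / s\<close>. The linear bound is
  \<open>a i \<le> sqrt (a i)\<close>. In the application \<open>a\<close> lists the eigenvalues of
  the compressed \<open>M M\<^sup>\<dagger>\<close> and \<open>r\<close> the diagonal of
  \<open>\<rho>\<close> in its eigenbasis.\<close>

lemma weighted_second_moment_bound: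
  fixes r a :: "'i \<Rightarrow> real"
  assumes "finite I" and r: "\<And>i. i \<in> I \<Longrightarrow> r i = 0 \<or> s \<le> r i" and "0 < s" and r1: "(\<Sum>i\<in>I. r i) = 1"
    and a: "\<And>i. i \<in> I \<Longrightarrow> 0 \<le> a i" "\<And>i. i \<in> I \<Longrightarrow> a i \<le> 1"
    and x: "x = 1 - (\<Sum>i\<in>I. r i * sqrt (a i))"
  shows "0 \<le> x" and "(\<Sum>i\<in>I. r i * a i) \<le> 1 - x" and "(\<Sum>i\<in>I. r i * a i) \<le> 1 - 2 * x + x\<^sup>2 / s"
proof -
  have r0: "0 \<le> r i" if "i \<in> I" for i using r[OF that] \<open>0 < s\<close> by auto
  define y where "y i = 1 - sqrt (a i)" for i
  have y: "0 \<le> y i" if "i \<in> I" for i using a[OF that] by (simp add: y_def)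
  have xy: "x = (\<Sum>i\<in>I. r i * y i)"
    by (simp add: x y_def right_diff_distrib sum_subtractf r1)
  show "0 \<le> x" unfolding xy using r0 y by (simp add: sum_nonneg)
  have "(\<Sum>i\<in>I. r i * a i) \<le> (\<Sum>i\<in>I. r i * sqrt (a i))"
  proof (intro sum_mono mult_left_mono r0)
    fix i assume "i \<in> I"
    then have "sqrt (a i) * sqrt (a i) \<le> 1 * sqrt (a i)"
      using a by (intro mult_right_mono) auto
    then show "a i \<le> sqrt (a i)" using a \<open>i \<in> I\<close> by simp
  qed
  then show "(\<Sum>i\<in>I. r i * a i) \<le> 1 - x" by (simp add: x)
  have "r i * a i \<le> r i - 2 * (r i * y i) + (r i * y i)\<^sup>2 / s" if i: "i \<in> I" for i
  proof -
    have "a i = (sqrt (a i))\<^sup>2" using a i by simp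
    then have ay: "a i = 1 - 2 * y i + (y i)\<^sup>2" by (simp add: y_def power2_eq_square algebra_simps)
    have "r i * a i = r i - 2 * (r i * y i) + r i * (y i)\<^sup>2" unfolding ay by (simp add: algebra_simps)
    moreover have "r i * (y i)\<^sup>2 \<le> (r i * y i)\<^sup>2 / s"
    proof -
      have "r i * s \<le> r i * r i" using r[OF i] r0[OF i] by (auto intro: mult_left_mono)
      then have "r i * s * (y i)\<^sup>2 \<le> r i * r i * (y i)\<^sup>2" by (intro mult_right_mono) auto
      then show ?thesis using \<open>0 < s\<close> by (simp add: power2_eq_square pos_le_divide_eq mult_ac)
    qed
    ultimately show ?thesis by linarith
  qed
  then have "(\<Sum>i\<in>I. r i * a i) \<le> (\<Sum>i\<in>I. r i - 2 * (r i * y i) + (r i * y i)\<^sup>2 / s)"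
    by (rule sum_mono)
  also have "\<dots> = 1 - 2 * x + (\<Sum>i\<in>I. (r i * y i)\<^sup>2) / s"
    by (simp add: sum.distrib sum_subtractf r1 xy sum_distrib_left sum_divide_distrib)
  also have "\<dots> \<le> 1 - 2 * x + x\<^sup>2 / s"
    unfolding xy using assms(1,3) r0 y by (simp add: divide_right_mono sum_squares_le_square_sum)
  finally show "(\<Sum>i\<in>I. r i * a i) \<le> 1 - 2 * x + x\<^sup>2 / s" .
qed

section \<open>Families of Kraus operators and the fidelity of a single encoder operator\<close>

lemma cscale_mult_vec: "cscale c A *v v = c *s (A *v v)"
  by (simp add: cscale_def matrix_vector_mult_def vec_eq_iff sum_distrib_left mult_ac)

lemma cscale_mult_left: "cscale c A ** B = cscale c (A ** B)"
  by (simp add: cscale_def matrix_matrix_mult_def vec_eq_iff sum_distrib_left mult_ac)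

lemma cscale_mult_right: "A ** cscale c B = cscale c (A ** B)"
  by (simp add: cscale_def matrix_matrix_mult_def vec_eq_iff sum_distrib_left mult_ac)

lemma matrix_mult_add_distrib_right:
  fixes A B :: "complex ^ 'n ^ 'm"
  shows "(A + B) ** C = A ** C + B ** C"
  by (simp add: matrix_matrix_mult_def vec_eq_iff distrib_right sum.distrib)

lemma trace_zero: "trace (0 :: complex ^ 'n ^ 'n) = 0"
  by (simp add: trace_def)

lemma trace_cscale: "trace (cscale c A) = c * trace A"
  by (simp add: cscale_def trace_def sum_distrib_left)

lemma sum_list_Cauchy_Schwarz:
  fixes a b :: "'a \<Rightarrow> real"
  shows "(\<Sum>x\<leftarrow>xs. a x * b x)\<^sup>2 \<le> (\<Sum>x\<leftarrow>xs. (a x)\<^sup>2) * (\<Sum>x\<leftarrow>xs. (b x)\<^sup>2)"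
  using Cauchy_Schwarz_ineq_sum[of "\<lambda>i. a (xs ! i)" "\<lambda>i. b (xs ! i)" "{0..<length xs}"]
  by (simp add: sum_list_sum_nth)

lemma norm_sum_list_le:
  assumes "\<And>x. norm (f x) \<le> g x"
  shows "norm (\<Sum>x\<leftarrow>xs. f x) \<le> (\<Sum>x\<leftarrow>xs. g x)"
  by (induction xs) (auto intro: order_trans[OF norm_triangle_ineq] add_mono assms)

definition contractive_family :: "(complex ^ 'n ^ 'm) list \<Rightarrow> bool" where
  "contractive_family Ls \<longleftrightarrow> (\<forall>v. (\<Sum>L\<leftarrow>Ls. (norm (L *v v))\<^sup>2) \<le> (norm v)\<^sup>2)"

definition kraus_fidelity ::
  "complex ^ 'l ^ 'l \<Rightarrow> (complex ^ 'c ^ 'l) list \<Rightarrow> complex ^ 'l ^ 'c \<Rightarrow> real" where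
  "kraus_fidelity \<rho> Ms K = (\<Sum>M\<leftarrow>Ms. (cmod (trace (\<rho> ** (M ** K))))\<^sup>2)"

lemma kraus_fidelity_nonneg: "0 \<le> kraus_fidelity \<rho> Ms K"
  unfolding kraus_fidelity_def by (rule sum_list_nonneg) auto

text \<open>A combination of the \<open>Ms\<close> with unit coefficient vector is again a
  contraction, and its fidelity is at most that of the family, both by Cauchy-Schwarz. Coefficients
  proportional to the conjugate traces at \<open>C\<close> give equality there.\<close>

lemma concentrate_fidelity:
  fixes Ms :: "(complex ^ 'c ^ 'l) list"
  assumes Ms: "contractive_family Ms" and pos: "0 < kraus_fidelity \<rho> Ms C"
  obtains M where "contractive M" and "(cmod (trace (\<rho> ** (M ** C))))\<^sup>2 = kraus_fidelity \<rho> Ms C"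
    and "\<And>K. (cmod (trace (\<rho> ** (M ** K))))\<^sup>2 \<le> kraus_fidelity \<rho> Ms K"
proof -
  define f where "f = kraus_fidelity \<rho> Ms C"
  define \<tau> where "\<tau> L = trace (\<rho> ** (L ** C))" for L
  define c where "c L = cnj (\<tau> L) / of_real (sqrt f)" for L
  define M where "M = (\<Sum>L\<leftarrow>Ms. cscale (c L) L)"
  have f: "0 < f" and f_eq: "(\<Sum>L\<leftarrow>Ms. (cmod (\<tau> L))\<^sup>2) = f"
    using pos by (simp_all add: f_def kraus_fidelity_def \<tau>_def)
  have "(cmod (c L))\<^sup>2 = (cmod (\<tau> L))\<^sup>2 * (1 / f)" for L
    using f by (simp add: c_def norm_divide power_divide)
  then have "(\<Sum>L\<leftarrow>Ms. (cmod (c L))\<^sup>2) = f * (1 / f)"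
    by (simp only: sum_list_mult_const f_eq)
  then have c1: "(\<Sum>L\<leftarrow>Ms. (cmod (c L))\<^sup>2) = 1"
    using f by simp
  have tr: "trace (\<rho> ** (M ** K)) = (\<Sum>L\<leftarrow>Ms. c L * trace (\<rho> ** (L ** K)))" for K
    unfolding M_def by (induction Ms)
      (simp_all add: matrix_mult_add_distrib_right matrix_add_ldistrib trace_add trace_cscale
        cscale_mult_left cscale_mult_right trace_zero)
  have mv: "M *v v = (\<Sum>L\<leftarrow>Ms. c L *s (L *v v))" for v
    unfolding M_def by (induction Ms) (simp_all add: matrix_vector_mult_add_rdistrib cscale_mult_vec)
  have "norm (M *v v) \<le> norm v" for v
  proof (rule power2_le_imp_le)
    have "norm (M *v v) \<le> (\<Sum>L\<leftarrow>Ms. cmod (c L) * norm (L *v v))"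
      unfolding mv by (rule norm_sum_list_le) (simp add: norm_vector_scale)
    then have "(norm (M *v v))\<^sup>2 \<le> (\<Sum>L\<leftarrow>Ms. cmod (c L) * norm (L *v v))\<^sup>2"
      by (rule power_mono) simp
    also have "\<dots> \<le> (norm v)\<^sup>2"
      using sum_list_Cauchy_Schwarz[of "\<lambda>L. cmod (c L)" "\<lambda>L. norm (L *v v)" Ms] Ms
      by (auto simp: c1 contractive_family_def intro: order_trans)
    finally show "(norm (M *v v))\<^sup>2 \<le> (norm v)\<^sup>2" .
  qed simp
  then have "contractive M" by (simp add: contractive_def)
  moreover have "(cmod (trace (\<rho> ** (M ** C))))\<^sup>2 = f"
  proof -
    have "c L * \<tau> L = of_real ((cmod (\<tau> L))\<^sup>2 * (1 / sqrt f))" for L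
      unfolding of_real_mult complex_norm_square by (simp add: c_def)
    moreover have "trace (\<rho> ** (M ** C)) = (\<Sum>L\<leftarrow>Ms. c L * \<tau> L)"
      unfolding tr \<tau>_def ..
    ultimately have "trace (\<rho> ** (M ** C)) = (\<Sum>L\<leftarrow>Ms. of_real ((cmod (\<tau> L))\<^sup>2 * (1 / sqrt f)))"
      by (simp only:)
    also have "\<dots> = of_real (\<Sum>L\<leftarrow>Ms. (cmod (\<tau> L))\<^sup>2 * (1 / sqrt f))"
      by (induction Ms) simp_all
    also have "\<dots> = of_real (f * (1 / sqrt f))" by (simp only: sum_list_mult_const f_eq)
    finally show ?thesis using f by (simp add: norm_divide power_divide power2_eq_square)
  qed
  moreover have "(cmod (trace (\<rho> ** (M ** K))))\<^sup>2 \<le> kraus_fidelity \<rho> Ms K" for K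
  proof -
    have "cmod (trace (\<rho> ** (M ** K))) \<le> (\<Sum>L\<leftarrow>Ms. cmod (c L) * cmod (trace (\<rho> ** (L ** K))))"
      unfolding tr by (rule norm_sum_list_le) (simp add: norm_mult)
    then have "(cmod (trace (\<rho> ** (M ** K))))\<^sup>2 \<le>
        (\<Sum>L\<leftarrow>Ms. cmod (c L) * cmod (trace (\<rho> ** (L ** K))))\<^sup>2"
      by (rule power_mono) simp
    also have "\<dots> \<le> kraus_fidelity \<rho> Ms K"
      using sum_list_Cauchy_Schwarz[of "\<lambda>L. cmod (c L)" "\<lambda>L. cmod (trace (\<rho> ** (L ** K)))" Ms]
      by (simp add: c1 kraus_fidelity_def)
    finally show ?thesis .
  qed
  ultimately show ?thesis using that by (simp add: f_def)
qed

text \<open>If every \<open>x\<close> with \<open>f x > 0\<close> had \<open>f x < g * a x\<close>,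
  where \<open>g\<close> is the total of \<open>f\<close>, summation would give
  \<open>g < g\<close>.\<close>

lemma exists_ratio_ge_average:
  fixes f a :: "'a \<Rightarrow> real"
  assumes "\<And>x. x \<in> set xs \<Longrightarrow> 0 \<le> a x" and "(\<Sum>x\<leftarrow>xs. a x) \<le> 1" and "0 < (\<Sum>x\<leftarrow>xs. f x)"
  obtains x where "x \<in> set xs" and "0 < f x" and "(\<Sum>x\<leftarrow>xs. f x) * a x \<le> f x"
proof (rule ccontr)
  define g where "g = (\<Sum>x\<leftarrow>xs. f x)"
  have g: "0 < g" using assms by (simp add: g_def)
  assume "\<not> thesis"
  then have "\<forall>x\<in>set xs. f x \<le> 0 \<or> f x < g * a x"
    using that unfolding g_def by force
  \<comment> \<open>Here \<open>g\<close> stays the total over the full list during the induction.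
    The first disjunct covers sublists without positive terms, in particular the empty one, where
    the strict inequality fails.\<close>
  with assms(1) have "(\<Sum>x\<leftarrow>xs. f x) \<le> 0 \<or> (\<Sum>x\<leftarrow>xs. f x) < g * (\<Sum>x\<leftarrow>xs. a x)"
  proof (induction xs)
    case (Cons y ys)
    from Cons.prems(1) have "0 \<le> a y" by simp
    moreover have "0 \<le> (\<Sum>x\<leftarrow>ys. a x)"
      by (rule sum_list_nonneg) (use Cons.prems(1) in auto)
    ultimately have "0 \<le> g * a y" "0 \<le> g * (\<Sum>x\<leftarrow>ys. a x)" using g by simp_all
    with Cons show ?case by (auto simp: distrib_left)
  qed simp
  moreover have "g * (\<Sum>x\<leftarrow>xs. a x) \<le> g" using assms(2) g by simp
  ultimately show False using g by (simp add: g_def)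
qed

section \<open>Encoders adapted to the state\<close>

text \<open>The hypotheses on the state in diagonal form: the unit trace becomes
  \<open>sum_p\<close>, while \<open>gap\<close> expresses both positivity and the smallest positive
  eigenvalue.\<close>

locale state_spectrum =
  fixes \<rho> :: "complex ^ 'l ^ 'l" and s :: real
    and e :: "'l \<Rightarrow> complex ^ 'l" and p :: "'l \<Rightarrow> real"
  assumes onb: "onb e"
    and eigen: "\<rho> *v e i = of_real (p i) *s e i"
    and sum_p: "(\<Sum>i\<in>UNIV. p i) = 1"
    and s_pos: "0 < s"
    and gap: "p i = 0 \<or> s \<le> p i"
begin

lemma p_nonneg: "0 \<le> p i"
  using gap[of i] s_pos by auto

lemma rho_eq: "\<rho> = spectral_matrix e p"
  by (rule onb_matrix_eqI[OF onb]) (simp add: eigen spectral_matrix_eigen[OF onb])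

lemma trace_rho: "trace (\<rho> ** A) = (\<Sum>i\<in>UNIV. of_real (p i) * cinner (e i) (A *v e i))"
  by (simp add: onb_trace[OF onb] matrix_vector_mul_assoc[symmetric] rho_eq cinner_spectral_matrix[OF onb])

lemma cinner_rho: "cinner v (\<rho> *v v) = of_real (\<Sum>i\<in>UNIV. p i * (cmod (cinner (e i) v))\<^sup>2)"
proof -
  have "cinner v (\<rho> *v v) = (\<Sum>i\<in>UNIV. of_real (p i) * (cinner (e i) v * cinner v (e i)))"
    unfolding rho_eq onb_cinner_sum[OF onb, of v "spectral_matrix e p *v v"]
    by (simp add: cinner_spectral_matrix[OF onb] mult_ac)
  also have "\<dots> = (\<Sum>i\<in>UNIV. of_real (p i * (cmod (cinner (e i) v))\<^sup>2))"
    unfolding of_real_mult complex_norm_square cnj_cinner ..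
  finally show ?thesis by simp
qed

section \<open>The support projection of the state\<close>

definition supp :: "complex ^ 'l ^ 'l" where
  "supp = spectral_matrix e (\<lambda>i. if p i = 0 then 0 else 1)"

lemma supp_eigen: "supp *v e i = (if p i = 0 then 0 else e i)"
  by (simp add: supp_def spectral_matrix_eigen[OF onb])

lemma dagger_supp: "dagger supp = supp"
  by (simp add: supp_def dagger_spectral_matrix)

lemma supp_supp: "supp ** supp = supp"
  by (rule onb_matrix_eqI[OF onb]) (simp add: matrix_vector_mul_assoc[symmetric] supp_eigen)

lemma rho_supp: "\<rho> ** supp = \<rho>"
  by (rule onb_matrix_eqI[OF onb]) (simp add: matrix_vector_mul_assoc[symmetric] supp_eigen eigen)

lemma norm_supp: "(norm (supp *v v))\<^sup>2 = (\<Sum>i\<in>UNIV. if p i = 0 then 0 else (cmod (cinner (e i) v))\<^sup>2)"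
  unfolding onb_parseval[OF onb, of "supp *v v"]
  by (intro sum.cong refl) (simp add: supp_def cinner_spectral_matrix[OF onb])

text \<open>The operator inequality \<open>\<rho> \<ge> s supp\<close>, read on quadratic forms; it
  holds eigenvalue by eigenvalue because of \<open>gap\<close>.\<close>

lemma rho_ge_supp: "s * (norm (supp *v v))\<^sup>2 \<le> (\<Sum>i\<in>UNIV. p i * (cmod (cinner (e i) v))\<^sup>2)"
  unfolding norm_supp sum_distrib_left
  using gap by (intro sum_mono) (auto intro!: mult_right_mono)

text \<open>This is \<open>tr (\<rho> A\<^sup>\<dagger> A)\<close>, a squared Hilbert-Schmidt norm
  weighted by the state and written in its eigenbasis.\<close>

definition weight :: "complex ^ 'l ^ 'm \<Rightarrow> real" where
  "weight A = (\<Sum>i\<in>UNIV. p i * (norm (A *v e i))\<^sup>2)"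

lemma weight_nonneg: "0 \<le> weight A"
  by (simp add: weight_def p_nonneg sum_nonneg)

lemma weight_conv_trace: "of_real (weight A) = trace (\<rho> ** (dagger A ** A))"
  by (simp add: weight_def trace_rho cinner_dagger_mult del: of_real_power)

text \<open>Cauchy-Schwarz for the form \<open>tr (\<rho> A\<^sup>\<dagger> B)\<close> with
  \<open>A = M\<^sup>\<dagger>\<close> and \<open>B = C\<close>; each \<open>p i\<close> is split
  into two square roots.\<close>

lemma trace_Cauchy_Schwarz:
  "(cmod (trace (\<rho> ** (M ** C))))\<^sup>2 \<le> weight C * weight (dagger M)"
proof -
  have "cmod (trace (\<rho> ** (M ** C))) \<le>
      (\<Sum>i\<in>UNIV. (sqrt (p i) * norm (C *v e i)) * (sqrt (p i) * norm (dagger M *v e i)))"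
    unfolding trace_rho
  proof (rule sum_norm_le)
    fix i
    have "cmod (cinner (e i) ((M ** C) *v e i)) \<le> norm (dagger M *v e i) * norm (C *v e i)"
      unfolding matrix_vector_mul_assoc[symmetric] cinner_matrix_right[of "e i" M] by (rule cmod_cinner_le)
    from mult_left_mono[OF this p_nonneg[of i]]
    show "norm (of_real (p i) * cinner (e i) ((M ** C) *v e i))
        \<le> (sqrt (p i) * norm (C *v e i)) * (sqrt (p i) * norm (dagger M *v e i))"
    proof -
      have "(sqrt (p i) * norm (C *v e i)) * (sqrt (p i) * norm (dagger M *v e i)) =
          (sqrt (p i) * sqrt (p i)) * (norm (dagger M *v e i) * norm (C *v e i))"
        by (simp only: mult_ac)
      then show ?thesis
        using \<open>p i * _ \<le> p i * _\<close> p_nonneg[of i]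
        by (simp only: norm_mult norm_of_real abs_of_nonneg real_sqrt_mult_self)
    qed
  qed
  then have "(cmod (trace (\<rho> ** (M ** C))))\<^sup>2 \<le>
      (\<Sum>i\<in>UNIV. (sqrt (p i) * norm (C *v e i)) * (sqrt (p i) * norm (dagger M *v e i)))\<^sup>2"
    by (intro power_mono) auto
  also have "\<dots> \<le> weight C * weight (dagger M)"
    using Cauchy_Schwarz_ineq_sum[of "\<lambda>i. sqrt (p i) * norm (C *v e i)"
        "\<lambda>i. sqrt (p i) * norm (dagger M *v e i)" UNIV]
    by (simp add: weight_def power_mult_distrib p_nonneg)
  finally show ?thesis .
qed

text \<open>
  Adding the support projection to \<open>M M\<^sup>\<dagger>\<close> before diagonalising forces every eigenvector into the
  support of \<open>\<rho>\<close> or its kernel, even where \<open>M M\<^sup>\<dagger>\<close> is degenerate.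
\<close>

lemma aligned_eigenbasis:
  fixes M :: "complex ^ 'c ^ 'l"
  assumes M: "contractive M" and supp_M: "supp ** M = M"
  obtains u a where "onb u" and "\<And>i. (M ** dagger M) *v u i = of_real (a i) *s u i"
    and "\<And>i. 0 \<le> a i" and "\<And>i. a i \<le> 1"
    and "\<And>i. (\<Sum>k\<in>UNIV. p k * (cmod (cinner (e k) (u i)))\<^sup>2) = 0 \<or>
      s \<le> (\<Sum>k\<in>UNIV. p k * (cmod (cinner (e k) (u i)))\<^sup>2)"
proof -
  define A where "A = M ** dagger M"
  have cA: "cinner v (A *v v) = of_real ((norm (dagger M *v v))\<^sup>2)" for v
    using cinner_dagger_mult[of v "dagger M"] by (simp add: A_def)
  have cS: "cinner v (supp *v v) = of_real ((norm (supp *v v))\<^sup>2)" for v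
    using cinner_dagger_mult[of v supp] by (simp add: dagger_supp supp_supp)
  have supp_A: "supp ** A = A" by (simp add: A_def matrix_mul_assoc supp_M)
  have "selfadjoint (A + supp)"
    by (simp add: selfadjoint_iff_dagger dagger_add dagger_supp A_def dagger_mult)
  then obtain u h where u: "onb u" and h: "\<And>i. (A + supp) *v u i = of_real (h i) *s u i"
    using spectral_theorem by blast
  have nu: "norm (u i) = 1" and uu: "cinner (u i) (u i) = 1" for i
    using u onb_norm[OF u] by (simp_all add: onb_def)
  define a where "a i = (norm (dagger M *v u i))\<^sup>2" for i
  define r where "r i = (\<Sum>k\<in>UNIV. p k * (cmod (cinner (e k) (u i)))\<^sup>2)" for i
  have main: "A *v u i = of_real (a i) *s u i \<and> (r i = 0 \<or> s \<le> r i)" for i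
  proof (cases "h i = 0")
    case True
    \<comment> \<open>Both summands are nonnegative, so a zero eigenvalue of the sum puts
      \<open>u i\<close> into the kernel of \<open>A\<close> and of \<open>supp\<close>, hence also
      of \<open>\<rho>\<close>.\<close>
    have "of_real (a i + (norm (supp *v u i))\<^sup>2) = cinner (u i) ((A + supp) *v u i)"
      by (simp add: matrix_vector_mult_add_rdistrib cinner_add_right cA cS a_def)
    also have "\<dots> = 0" by (simp add: h True)
    finally have "a i + (norm (supp *v u i))\<^sup>2 = 0" by (simp only: of_real_eq_0_iff)
    then have a0: "a i = 0" and s0: "supp *v u i = 0"
      by (auto simp: a_def add_nonneg_eq_0_iff)
    have "\<rho> *v u i = \<rho> *v (supp *v u i)"
      by (simp add: matrix_vector_mul_assoc rho_supp)
    then have "\<rho> *v u i = 0" by (simp add: s0)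
    then have "complex_of_real (r i) = 0" unfolding r_def cinner_rho[symmetric] by simp
    then have "r i = 0" by (simp only: of_real_eq_0_iff)
    moreover have "A *v u i = M *v (dagger M *v u i)" by (simp add: A_def matrix_vector_mul_assoc)
    ultimately show ?thesis using a0 by (simp add: a_def)
  next
    case False
    \<comment> \<open>The range of \<open>A + supp\<close> lies in the support, so an eigenvector
      with nonzero eigenvalue is fixed by \<open>supp\<close>. It is then an eigenvector of
      \<open>A\<close> with eigenvalue lowered by \<open>1\<close>.\<close>
    have "of_real (h i) *s (supp *v u i) = supp *v ((A + supp) *v u i)"
      by (simp add: h vector_scalar_commute)
    also have "\<dots> = (A + supp) *v u i"
      by (simp add: matrix_vector_mul_assoc matrix_add_ldistrib supp_A supp_supp)
    also have "\<dots> = of_real (h i) *s u i" by (rule h)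
    finally have su: "supp *v u i = u i" using False by simp
    have Au: "A *v u i = of_real (h i - 1) *s u i"
      using h[of i] by (simp add: matrix_vector_mult_add_rdistrib su vector_sub_rdistrib eq_diff_eq)
    have "complex_of_real (a i) = cinner (u i) (A *v u i)" by (simp add: cA a_def)
    also have "\<dots> = of_real (h i - 1)" unfolding Au cinner_scale_right uu by simp
    finally have "a i = h i - 1" by (simp only: of_real_eq_iff)
    then show ?thesis using Au rho_ge_supp[of "u i"] by (simp add: r_def su nu)
  qed
  show ?thesis
  proof (rule that[OF u, of a])
    show "a i \<le> 1" for i
      using contractive_dagger[OF M] nu[of i] unfolding a_def
      by (metis contractive_def norm_ge_zero power_le_one)
  qed (use main in \<open>simp_all add: A_def r_def a_def\<close>)
qed

lemma weight_dagger_supp: "weight (dagger (supp ** M)) = weight (dagger M)"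
  unfolding weight_def by (intro sum.cong refl)
    (simp add: dagger_mult dagger_supp supp_eigen matrix_vector_mul_assoc[symmetric])

text \<open>After compression of \<open>M\<close> to the support, \<open>K\<close> is the partial
  isometry \<open>M\<^sup>\<dagger> |M\<^sup>\<dagger>|\<^sup>-\<^sup>1\<close>, the inverse being a
  pseudo-inverse. Then \<open>M K\<close> is \<open>|M\<^sup>\<dagger>|\<close>, with eigenvalues
  \<open>sqrt (a i)\<close>, and the weight is the mean of the \<open>a i\<close>, so the scalar
  second-moment bound applies.\<close>

lemma near_optimal_encoder:
  fixes M :: "complex ^ 'c ^ 'l"
  assumes M: "contractive M"
  obtains K x where "contractive K" and "trace (\<rho> ** (M ** K)) = of_real (1 - x)" and "0 \<le> x"
    and "weight (dagger M) \<le> 1 - x" and "weight (dagger M) \<le> 1 - 2 * x + x\<^sup>2 / s"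
proof -
  define M' where "M' = supp ** M"
  have "norm (supp *v v) \<le> norm v" for v
  proof (rule power2_le_imp_le)
    show "(norm (supp *v v))\<^sup>2 \<le> (norm v)\<^sup>2"
      unfolding norm_supp onb_parseval[OF onb, of v] by (intro sum_mono) simp
  qed simp
  then have M': "contractive M'"
    using M unfolding contractive_def M'_def matrix_vector_mul_assoc[symmetric]
    by (auto intro: order_trans)
  have "supp ** M' = M'" by (simp add: M'_def matrix_mul_assoc supp_supp)
  then obtain u a where u: "onb u"
    and Au: "\<And>i. (M' ** dagger M') *v u i = of_real (a i) *s u i"
    and a: "\<And>i. 0 \<le> a i" "\<And>i. a i \<le> 1"
    and gap_u: "\<And>i. (\<Sum>k\<in>UNIV. p k * (cmod (cinner (e k) (u i)))\<^sup>2) = 0 \<or>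
      s \<le> (\<Sum>k\<in>UNIV. p k * (cmod (cinner (e k) (u i)))\<^sup>2)"
    by (rule aligned_eigenbasis[OF M']) (rule that)
  define r where "r i = (\<Sum>k\<in>UNIV. p k * (cmod (cinner (e k) (u i)))\<^sup>2)" for i
  have r: "cinner (u i) (\<rho> *v u i) = of_real (r i)" for i
    unfolding r_def by (rule cinner_rho)
  \<comment> \<open>The state need not be diagonal in \<open>u\<close>, but only its diagonal
    \<open>r\<close> enters the trace against an operator that is.\<close>
  have tr: "trace (\<rho> ** B) = of_real (\<Sum>i\<in>UNIV. r i * b i)"
    if "\<And>i. B *v u i = of_real (b i) *s u i" for B b
    by (simp add: onb_trace[OF u] that r matrix_vector_mul_assoc[symmetric] vector_scalar_commute
        cinner_scale_right mult.commute)
  have "trace \<rho> = of_real (\<Sum>i\<in>UNIV. p i)"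
    using trace_rho[of "mat 1"] onb by (simp add: onb_def)
  then have "complex_of_real (\<Sum>i\<in>UNIV. r i) = of_real 1"
    using tr[of "mat 1" "\<lambda>_. 1"] by (simp add: sum_p)
  then have r1: "(\<Sum>i\<in>UNIV. r i) = 1" by (simp only: of_real_eq_iff)
  have "complex_of_real (weight (dagger M)) = of_real (\<Sum>i\<in>UNIV. r i * a i)"
    unfolding weight_dagger_supp[of M, folded M'_def, symmetric] weight_conv_trace
    using tr[OF Au] by simp
  then have w: "weight (dagger M) = (\<Sum>i\<in>UNIV. r i * a i)" by (simp only: of_real_eq_iff)
  \<comment> \<open>Since \<open>inverse 0 = 0\<close>, this is the spectrum of the pseudo-inverse,
    and the facts \<open>da\<close> below also hold where \<open>a i = 0\<close>.\<close>
  define d where "d i = inverse (sqrt (a i))" for i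
  define K where "K = dagger M' ** spectral_matrix u d"
  have da: "d i * a i = sqrt (a i)" "d i * d i * a i \<le> 1" for i
    using a(1)[of i] by (cases "a i = 0"; simp add: d_def field_simps)+
  define x where "x = 1 - (\<Sum>i\<in>UNIV. r i * sqrt (a i))"
  have MK: "(M' ** K) *v u i = of_real (sqrt (a i)) *s u i" for i
  proof -
    have "(M' ** K) *v u i = (M' ** dagger M') *v (spectral_matrix u d *v u i)"
      by (simp add: K_def matrix_vector_mul_assoc matrix_mul_assoc)
    then show ?thesis
      by (simp add: spectral_matrix_eigen[OF u] vector_scalar_commute Au da(1)[symmetric])
  qed
  have "norm (K *v v) \<le> norm v" for v
  proof (rule power2_le_imp_le)
    define w where "w = spectral_matrix u d *v v"
    have "complex_of_real ((norm (K *v v))\<^sup>2) = cinner w ((M' ** dagger M') *v w)"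
      using cinner_dagger_mult[of w "dagger M'"] by (simp add: K_def w_def matrix_vector_mul_assoc)
    also have "\<dots> = (\<Sum>i\<in>UNIV. of_real (d i * d i * a i * (cmod (cinner (u i) v))\<^sup>2))"
      unfolding onb_cinner_sum[OF u, of w "(M' ** dagger M') *v w"]
    proof (intro sum.cong refl)
      fix i
      have uw: "cinner (u i) w = of_real (d i) * cinner (u i) v"
        unfolding w_def by (rule cinner_spectral_matrix[OF u])
      have wu: "cinner w (u i) = of_real (d i) * cnj (cinner (u i) v)"
        unfolding cnj_cinner[of "u i" w, symmetric] uw by simp
      have "cinner (u i) ((M' ** dagger M') *v w) = cinner ((M' ** dagger M') *v u i) w"
        using cinner_matrix_right[of "u i" "M' ** dagger M'" w] by (simp add: dagger_mult)
      also have "\<dots> = of_real (a i) * cinner (u i) w"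
        by (simp add: Au cinner_scale_left)
      finally show "cinner w (u i) * cinner (u i) ((M' ** dagger M') *v w) =
          of_real (d i * d i * a i * (cmod (cinner (u i) v))\<^sup>2)"
        unfolding of_real_mult complex_norm_square by (simp add: uw wu mult_ac)
    qed
    finally have "(norm (K *v v))\<^sup>2 = (\<Sum>i\<in>UNIV. d i * d i * a i * (cmod (cinner (u i) v))\<^sup>2)"
      by (simp only: of_real_sum[symmetric] of_real_eq_iff)
    also have "\<dots> \<le> (\<Sum>i\<in>UNIV. 1 * (cmod (cinner (u i) v))\<^sup>2)"
      using da(2) by (intro sum_mono mult_right_mono) auto
    also have "\<dots> = (norm v)\<^sup>2" by (simp add: onb_parseval[OF u, of v])
    finally show "(norm (K *v v))\<^sup>2 \<le> (norm v)\<^sup>2" .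
  qed simp
  then have "contractive K" by (simp add: contractive_def)
  moreover have "trace (\<rho> ** (M ** K)) = of_real (1 - x)"
  proof -
    have "\<rho> ** (M ** K) = \<rho> ** (M' ** K)"
      by (simp add: M'_def matrix_mul_assoc rho_supp)
    then show ?thesis using tr[OF MK] by (simp add: x_def)
  qed
  ultimately show ?thesis
    using that[of K x] weighted_second_moment_bound[OF finite gap_u[folded r_def] s_pos r1 a x_def]
    by (simp add: w)
qed

lemma sum_weight_le_one:
  assumes "contractive_family Cs"
  shows "(\<Sum>C\<leftarrow>Cs. weight C) \<le> 1"
proof -
  have "(\<Sum>C\<leftarrow>Cs. weight C) = (\<Sum>i\<in>UNIV. p i * (\<Sum>C\<leftarrow>Cs. (norm (C *v e i))\<^sup>2))"
    by (induction Cs) (simp_all add: weight_def sum.distrib distrib_left)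
  also have "\<dots> \<le> (\<Sum>i\<in>UNIV. p i * 1)"
    using assms[unfolded contractive_family_def, rule_format, of "e _"]
    by (intro sum_mono mult_left_mono p_nonneg) (simp add: onb_norm[OF onb])
  finally show ?thesis by (simp add: sum_p)
qed

text \<open>On the support, the squared operator norm of \<open>C\<close> is at most its squared
  Hilbert-Schmidt norm, and this is at most \<open>weight C / s\<close> since each nonzero
  \<open>p i\<close> is at least \<open>s\<close>. This allows the scaling by
  \<open>sqrt (s / weight C)\<close>, under which the fidelity scales quadratically. The restriction
  itself leaves the traces unchanged, as \<open>p i\<close> vanishes off the support.\<close>

lemma rescaled_encoder:
  fixes C :: "complex ^ 'l ^ 'c"
  assumes "0 < weight C"
  obtains K where "contractive K"
    and "\<And>Ms. kraus_fidelity \<rho> Ms K = s / weight C * kraus_fidelity \<rho> Ms C"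
proof -
  define t where "t = s / weight C"
  have t: "0 < t" using assms s_pos by (simp add: t_def)
  define K where "K = cscale (of_real (sqrt t)) (C ** supp)"
  have "norm (K *v v) \<le> norm v" for v
  proof (rule power2_le_imp_le)
    define \<delta> where "\<delta> i = (if p i = 0 then 0 else 1 :: real)" for i
    have "(C ** supp) *v v = (\<Sum>i\<in>UNIV. cinner (e i) v *s (of_real (\<delta> i) *s (C *v e i)))"
      unfolding matrix_vector_mul_assoc[symmetric] supp_def spectral_matrix_mult
        matrix_vector_mult_sum_right vector_scalar_commute
      by (intro sum.cong refl) (simp add: \<delta>_def)
    then have "norm ((C ** supp) *v v) \<le> (\<Sum>i\<in>UNIV. cmod (cinner (e i) v) * (\<delta> i * norm (C *v e i)))"
      by (simp only:) (rule sum_norm_le, simp add: norm_vector_scale \<delta>_def)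
    then have "(norm ((C ** supp) *v v))\<^sup>2 \<le>
        (\<Sum>i\<in>UNIV. cmod (cinner (e i) v) * (\<delta> i * norm (C *v e i)))\<^sup>2"
      by (rule power_mono) simp
    also have "\<dots> \<le> (norm v)\<^sup>2 * (\<Sum>i\<in>UNIV. (\<delta> i * norm (C *v e i))\<^sup>2)"
      unfolding onb_parseval[OF onb, of v] by (rule Cauchy_Schwarz_ineq_sum)
    also have "\<dots> \<le> (norm v)\<^sup>2 * (weight C / s)"
    proof (rule mult_left_mono)
      have "s * (\<delta> i * norm (C *v e i))\<^sup>2 \<le> p i * (norm (C *v e i))\<^sup>2" for i
        using gap[of i] by (auto simp: \<delta>_def intro: mult_right_mono)
      then have "s * (\<Sum>i\<in>UNIV. (\<delta> i * norm (C *v e i))\<^sup>2) \<le> weight C"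
        unfolding weight_def sum_distrib_left by (rule sum_mono)
      then show "(\<Sum>i\<in>UNIV. (\<delta> i * norm (C *v e i))\<^sup>2) \<le> weight C / s"
        using s_pos by (simp add: pos_le_divide_eq mult.commute)
    qed simp
    finally have "t * (norm ((C ** supp) *v v))\<^sup>2 \<le> t * ((norm v)\<^sup>2 * (weight C / s))"
      using t by (intro mult_left_mono) auto
    also have "\<dots> = (norm v)\<^sup>2" using assms s_pos by (simp add: t_def)
    finally show "(norm (K *v v))\<^sup>2 \<le> (norm v)\<^sup>2"
      using t by (simp add: K_def cscale_mult_vec norm_vector_scale power_mult_distrib)
  qed simp
  then have "contractive K" by (simp add: contractive_def)
  moreover have "kraus_fidelity \<rho> Ms K = t * kraus_fidelity \<rho> Ms C" for Ms :: "(complex ^ 'c ^ 'l) list"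
  proof -
    have "trace (\<rho> ** (M ** (C ** supp))) = trace (\<rho> ** (M ** C))" for M :: "complex ^ 'c ^ 'l"
      unfolding trace_rho by (intro sum.cong refl)
        (simp add: matrix_vector_mul_assoc[symmetric] supp_eigen)
    then have "trace (\<rho> ** (M ** K)) = of_real (sqrt t) * trace (\<rho> ** (M ** C))" for M :: "complex ^ 'c ^ 'l"
      by (simp add: K_def cscale_mult_right trace_cscale)
    then show ?thesis using t
      by (simp add: kraus_fidelity_def norm_mult power_mult_distrib sum_list_const_mult)
  qed
  ultimately show ?thesis using that by (simp add: t_def)
qed

text \<open>One operator \<open>C\<close> with above-average ratio of fidelity to weight feeds both
  constructions: rescaling \<open>C\<close> gives \<open>K'\<close>, and the combination
  \<open>M\<close> concentrated at \<open>C\<close> gives \<open>K\<close>.\<close>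

lemma rank_one_encoders:
  fixes Ms :: "(complex ^ 'c ^ 'l) list"
  assumes Ms: "contractive_family Ms" and Cs: "contractive_family Cs"
    and g: "g = (\<Sum>C\<leftarrow>Cs. kraus_fidelity \<rho> Ms C)" "0 < g"
  obtains K K' x where "contractive K" and "contractive K'" and "0 \<le> x" and "g \<le> 1 - x"
    and "g \<le> 1 - 2 * x + x\<^sup>2 / s"
    and "(1 - x)\<^sup>2 \<le> kraus_fidelity \<rho> Ms K" and "s * g \<le> kraus_fidelity \<rho> Ms K'"
proof -
  obtain C where C: "C \<in> set Cs" "0 < kraus_fidelity \<rho> Ms C" "g * weight C \<le> kraus_fidelity \<rho> Ms C"
    using exists_ratio_ge_average[of Cs weight "kraus_fidelity \<rho> Ms"] sum_weight_le_one[OF Cs]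
      weight_nonneg g by blast
  obtain M where M: "contractive M" "(cmod (trace (\<rho> ** (M ** C))))\<^sup>2 = kraus_fidelity \<rho> Ms C"
    and M_le: "\<And>K. (cmod (trace (\<rho> ** (M ** K))))\<^sup>2 \<le> kraus_fidelity \<rho> Ms K"
    using concentrate_fidelity[OF Ms C(2)] by blast
  have le: "kraus_fidelity \<rho> Ms C \<le> weight C * weight (dagger M)"
    unfolding M(2)[symmetric] by (rule trace_Cauchy_Schwarz)
  have pos: "0 < weight C"
    using le C(2) weight_nonneg[of C] by (cases "weight C = 0") auto
  \<comment> \<open>The above-average choice and Cauchy-Schwarz sandwich the fidelity of
    \<open>C\<close>; cancelling its weight transfers \<open>g\<close> to \<open>M\<close>.\<close>
  have "g * weight C \<le> weight (dagger M) * weight C"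
    using C(3) le by (simp add: mult.commute)
  then have gw: "g \<le> weight (dagger M)" using pos by simp
  obtain K x where K: "contractive K" "trace (\<rho> ** (M ** K)) = of_real (1 - x)" "0 \<le> x"
    "weight (dagger M) \<le> 1 - x" "weight (dagger M) \<le> 1 - 2 * x + x\<^sup>2 / s"
    using near_optimal_encoder[OF M(1)] .
  obtain K' where K': "contractive K'" "kraus_fidelity \<rho> Ms K' = s / weight C * kraus_fidelity \<rho> Ms C"
    using rescaled_encoder[OF pos] by blast
  have "s * g \<le> kraus_fidelity \<rho> Ms K'"
    using mult_left_mono[OF C(3), of s] pos s_pos by (simp add: K'(2) pos_le_divide_eq mult_ac)
  moreover have "(1 - x)\<^sup>2 \<le> kraus_fidelity \<rho> Ms K"
    using M_le[of K] by (simp add: K(2) del: of_real_diff)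
  ultimately show ?thesis using that[of K K' x] K K'(1) gw by linarith
qed

end

section \<open>Kraus families and the optimal fidelities\<close>

lemma state_spectrum_exists:
  fixes \<rho> :: "complex ^ 'l ^ 'l"
  assumes "state \<rho>" and s: "smallest_pos_eigenvalue \<rho> s"
  obtains e p where "state_spectrum \<rho> s e p"
proof -
  have psd: "psd \<rho>" and tr: "trace \<rho> = 1" using assms by (auto simp: state_def)
  obtain e p where e: "onb e" and p: "\<And>i. \<rho> *v e i = of_real (p i) *s e i"
    using spectral_theorem[OF psd_imp_selfadjoint[OF psd]] by blast
  have ep: "cinner (e i) (\<rho> *v e i) = of_real (p i)" for i
    using e by (simp add: p cinner_scale_right onb_def)
  have "0 \<le> p i" for i
    using psd unfolding psd_def by (metis ep nonneg_Reals_of_real_iff)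
  moreover have "p i = 0 \<or> s \<le> p i" if "0 \<le> p i" for i
  proof -
    have "e i \<noteq> 0" using onb_norm[OF e, of i] by auto
    then have "eigenvalue \<rho> (of_real (p i))" using p unfolding eigenvalue_def by blast
    then show ?thesis using s that unfolding smallest_pos_eigenvalue_def by (metis order_le_less)
  qed
  moreover have "(\<Sum>i\<in>UNIV. p i) = 1"
  proof -
    have "complex_of_real (\<Sum>i\<in>UNIV. p i) = of_real 1"
      using onb_trace[OF e, of \<rho>] by (simp add: ep tr)
    then show ?thesis by (simp only: of_real_eq_iff)
  qed
  ultimately have "state_spectrum \<rho> s e p"
    using e p s by unfold_locales (auto simp: smallest_pos_eigenvalue_def)
  then show ?thesis by (rule that)
qed

section \<open>Composition of Kraus families and maps with one Kraus operator\<close>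

definition kraus_comp :: "(complex ^ 'm ^ 'k) list \<Rightarrow> (complex ^ 'n ^ 'm) list \<Rightarrow> (complex ^ 'n ^ 'k) list" where
  "kraus_comp As Bs = concat (map (\<lambda>B. map (\<lambda>A. A ** B) As) Bs)"

lemma sum_list_kraus_comp:
  "(\<Sum>X\<leftarrow>kraus_comp As Bs. f X) = (\<Sum>B\<leftarrow>Bs. \<Sum>A\<leftarrow>As. f (A ** B))"
  by (induction Bs) (simp_all add: kraus_comp_def comp_def)

lemma kraus_kraus_comp:
  assumes A: "kraus \<Phi> As" and B: "kraus \<Psi> Bs"
  shows "kraus (\<Phi> \<circ> \<Psi>) (kraus_comp As Bs)"
proof -
  have zero: "\<Phi> 0 = 0"
    unfolding A[unfolded kraus_def, rule_format] by (induction As) simp_all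
  have add: "\<Phi> (X + Y) = \<Phi> X + \<Phi> Y" for X Y
    unfolding A[unfolded kraus_def, rule_format]
    by (induction As) (simp_all add: matrix_add_ldistrib matrix_mult_add_distrib_right)
  have sum: "\<Phi> (\<Sum>B\<leftarrow>Bs. f B) = (\<Sum>B\<leftarrow>Bs. \<Phi> (f B))" for f and Bs :: "'z list"
    by (induction Bs) (simp_all add: zero add)
  have "(\<Phi> \<circ> \<Psi>) X = (\<Sum>B\<leftarrow>Bs. \<Phi> (B ** X ** dagger B))" for X
    using B by (simp add: kraus_def sum)
  also have "(\<Sum>B\<leftarrow>Bs. \<Phi> (B ** X ** dagger B)) = (\<Sum>L\<leftarrow>kraus_comp As Bs. L ** X ** dagger L)" for X
    using A by (simp add: kraus_def sum_list_kraus_comp dagger_mult matrix_mul_assoc)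
  finally show ?thesis by (simp add: kraus_def)
qed

lemma contractive_family_kraus_comp:
  assumes "contractive_family As" and "contractive_family Bs"
  shows "contractive_family (kraus_comp As Bs)"
  unfolding contractive_family_def
proof
  fix v
  have "(\<Sum>L\<leftarrow>kraus_comp As Bs. (norm (L *v v))\<^sup>2) = (\<Sum>B\<leftarrow>Bs. \<Sum>A\<leftarrow>As. (norm (A *v (B *v v)))\<^sup>2)"
    by (simp add: sum_list_kraus_comp matrix_vector_mul_assoc)
  also have "\<dots> \<le> (\<Sum>B\<leftarrow>Bs. (norm (B *v v))\<^sup>2)"
    using assms(1) by (intro sum_list_mono) (simp add: contractive_family_def)
  also have "\<dots> \<le> (norm v)\<^sup>2"
    using assms(2) by (simp add: contractive_family_def)
  finally show "(\<Sum>L\<leftarrow>kraus_comp As Bs. (norm (L *v v))\<^sup>2) \<le> (norm v)\<^sup>2" .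
qed

lemma cptni_kraus:
  assumes "cptni \<Phi>"
  obtains Ls where "kraus \<Phi> Ls" and "contractive_family Ls"
  using assms by (auto simp: cptni_def loewner_le_one_iff contractive_family_def)

lemma completely_positive_conj:
  fixes K :: "complex ^ 'n ^ 'm"
  shows "completely_positive (\<lambda>X. K ** X ** dagger K)"
  unfolding completely_positive_def
proof (intro conjI allI impI)
  show "operator_linear (\<lambda>X. K ** X ** dagger K)"
    by (simp add: operator_linear_def matrix_add_ldistrib matrix_mult_add_distrib_right
      cscale_mult_left cscale_mult_right)
next
  fix k and X :: "nat \<Rightarrow> nat \<Rightarrow> complex ^ 'n ^ 'n"
  assume "block_psd k X"
  have "cinner v ((K ** X i j ** dagger K) *v w) = cinner (dagger K *v v) (X i j *v (dagger K *v w))" for v w i j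
    by (simp only: matrix_vector_mul_assoc[symmetric] cinner_matrix_right[of v K])
  then show "block_psd k (\<lambda>i j. K ** X i j ** dagger K)"
    using \<open>block_psd k X\<close> by (simp add: block_psd_def)
qed

lemma kraus_single: "kraus (\<lambda>X. K ** X ** dagger K) [K]"
  by (simp add: kraus_def)

text \<open>The rank bound is an inequality because \<open>K = 0\<close> gives the zero map, which
  has the empty Kraus family.\<close>

lemma cptni_conj:
  assumes "contractive K"
  shows "cptni (\<lambda>X. K ** X ** dagger K)" and "choi_rank (\<lambda>X. K ** X ** dagger K) \<le> 1"
proof -
  have "loewner_le (\<Sum>L\<leftarrow>[K]. dagger L ** L) (mat 1)"
    unfolding loewner_le_one_iff using assms by (simp add: contractive_def power_mono)
  then show "cptni (\<lambda>X. K ** X ** dagger K)"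
    unfolding cptni_def using completely_positive_conj kraus_single by blast
  show "choi_rank (\<lambda>X. K ** X ** dagger K) \<le> 1"
    unfolding choi_rank_def by (rule Least_le) (use kraus_single[of K] in \<open>auto intro!: exI[of _ "[K]"]\<close>)
qed

lemma ent_fidelity_comp:
  assumes "kraus \<Phi> Ms" and "kraus \<Psi> Cs"
  shows "ent_fidelity \<rho> (\<Phi> \<circ> \<Psi>) = (\<Sum>C\<leftarrow>Cs. kraus_fidelity \<rho> Ms C)"
  by (simp add: ent_fidelity_kraus[OF kraus_kraus_comp[OF assms]] sum_list_kraus_comp kraus_fidelity_def)

lemma ent_fidelity_nonneg:
  assumes "cptni C" and "cptni D" and "cptni N"
  shows "0 \<le> ent_fidelity \<rho> (D \<circ> N \<circ> C)"
proof -
  obtain Cs Ds Ns where "kraus C Cs" "kraus D Ds" "kraus N Ns"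
    using assms cptni_kraus by metis
  then show ?thesis
    by (auto simp: ent_fidelity_comp[OF kraus_kraus_comp] intro!: sum_list_nonneg kraus_fidelity_nonneg)
qed

text \<open>Noise and decoder merge into one Kraus family, so both new codes keep the decoder
  \<open>D\<close> and change only the encoder.\<close>

lemma (in state_spectrum) rank_one_codes:
  fixes C :: "complex ^ 'l ^ 'l \<Rightarrow> complex ^ 'c ^ 'c"
  assumes "cptni C" and "cptni D" and "cptni N"
    and g: "g = ent_fidelity \<rho> (D \<circ> N \<circ> C)" "0 < g"
  obtains C\<^sub>1 C\<^sub>2 :: "complex ^ 'l ^ 'l \<Rightarrow> complex ^ 'c ^ 'c" and x
  where "cptni C\<^sub>1" and "choi_rank C\<^sub>1 \<le> 1" and "cptni C\<^sub>2" and "choi_rank C\<^sub>2 \<le> 1"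
    and "0 \<le> x" and "g \<le> 1 - x" and "g \<le> 1 - 2 * x + x\<^sup>2 / s"
    and "(1 - x)\<^sup>2 \<le> ent_fidelity \<rho> (D \<circ> N \<circ> C\<^sub>1)" and "s * g \<le> ent_fidelity \<rho> (D \<circ> N \<circ> C\<^sub>2)"
proof -
  obtain Cs where Cs: "kraus C Cs" "contractive_family Cs" using cptni_kraus[OF assms(1)] .
  obtain Ds where Ds: "kraus D Ds" "contractive_family Ds" using cptni_kraus[OF assms(2)] .
  obtain Ns where Ns: "kraus N Ns" "contractive_family Ns" using cptni_kraus[OF assms(3)] .
  define Ms where "Ms = kraus_comp Ds Ns"
  have Ms: "kraus (D \<circ> N) Ms" "contractive_family Ms"
    unfolding Ms_def using Ds Ns by (simp_all add: kraus_kraus_comp contractive_family_kraus_comp)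
  have single: "ent_fidelity \<rho> (D \<circ> N \<circ> (\<lambda>X. K ** X ** dagger K)) = kraus_fidelity \<rho> Ms K" for K
    by (simp add: ent_fidelity_comp[OF Ms(1) kraus_single])
  have "g = (\<Sum>C\<leftarrow>Cs. kraus_fidelity \<rho> Ms C)"
    using ent_fidelity_comp[OF Ms(1) Cs(1)] g by simp
  from rank_one_encoders[OF Ms(2) Cs(2) this g(2)] obtain K K' x where
    "contractive K" "contractive K'" "0 \<le> x" "g \<le> 1 - x" "g \<le> 1 - 2 * x + x\<^sup>2 / s"
    "(1 - x)\<^sup>2 \<le> kraus_fidelity \<rho> Ms K" "s * g \<le> kraus_fidelity \<rho> Ms K'" .
  then show ?thesis
    by (intro that[of "\<lambda>X. K ** X ** dagger K" "\<lambda>X. K' ** X ** dagger K'" x])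
      (simp_all only: single cptni_conj)
qed

section \<open>The scalar bound and its quadratic equation\<close>

lemma quadratic_deficit_antimono:
  fixes s :: real
  assumes "0 < s" and "l \<le> x" and "x \<le> s"
  shows "1 - 2 * x + x\<^sup>2 / s \<le> 1 - 2 * l + l\<^sup>2 / s"
proof -
  have "(s - x)\<^sup>2 \<le> (s - l)\<^sup>2" using assms by (intro power_mono) auto
  then have "(s - x)\<^sup>2 / s \<le> (s - l)\<^sup>2 / s" using assms by (intro divide_right_mono) auto
  \<comment> \<open>Completing the square shows a parabola with vertex at \<open>t = s\<close> and
    minimum \<open>1 - s\<close>; it decreases to the left of \<open>s\<close>.\<close>
  moreover have "1 - 2 * t + t\<^sup>2 / s = (s - t)\<^sup>2 / s + 1 - s" for t
    using assms by (simp add: power2_eq_square field_simps)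
  ultimately show ?thesis by simp
qed

text \<open>In terms of \<open>t = sqrt (1 - \<epsilon> / s)\<close> one has
  \<open>\<epsilon> = s * (1 - t) * (1 + t)\<close>, so \<open>ell s \<epsilon>\<close> simplifies
  to \<open>s * (1 - t)\<close>.\<close>

lemma ell_properties:
  assumes "0 < s" and "0 \<le> \<epsilon>" and "\<epsilon> \<le> s"
  shows "ell s \<epsilon> \<le> s"
    and "\<epsilon> = 2 * ell s \<epsilon> - (ell s \<epsilon>)\<^sup>2 / s"
proof -
  define t where "t = sqrt (1 - \<epsilon> / s)"
  have t: "0 \<le> t" "t\<^sup>2 = 1 - \<epsilon> / s" using assms by (simp_all add: t_def)
  have \<epsilon>: "\<epsilon> = s * (1 - t) * (1 + t)"
    using t(2) assms(1) by (simp add: power2_eq_square field_simps)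
  have "1 + t \<noteq> 0" using t(1) by simp
  have "ell s \<epsilon> = \<epsilon> / (1 + t)" by (simp add: ell_def t_def)
  also have "\<dots> = s * (1 - t)"
    using \<open>1 + t \<noteq> 0\<close> \<epsilon> by (metis nonzero_mult_div_cancel_right)
  finally have ell: "ell s \<epsilon> = s * (1 - t)" .
  show "ell s \<epsilon> \<le> s" unfolding ell using t(1) assms(1) by simp
  show "\<epsilon> = 2 * ell s \<epsilon> - (ell s \<epsilon>)\<^sup>2 / s"
  proof -
    have "(s * (1 - t))\<^sup>2 / s = s * (1 - t)\<^sup>2"
      using assms(1) by (simp add: power2_eq_square)
    then show ?thesis unfolding ell using \<epsilon> by (simp add: power2_eq_square algebra_simps)
  qed
qed

text \<open>For deficit \<open>1 - F \<le> s\<close>, the quadratic bound gives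
  \<open>1 - sqrt F\<^sub>1 \<le> ell s (1 - F)\<close>, that is, a lower bound on
  \<open>F\<^sub>1\<close>. For larger deficit, the two entries of the minimum come from
  \<open>F\<^sup>2 \<le> F\<^sub>1\<close> and \<open>s * F \<le> F\<^sub>1\<close>.\<close>

lemma Delta_bar_bound:
  fixes F F\<^sub>1 s :: real
  assumes s: "0 < s" "s \<le> 1" and F1: "0 \<le> F\<^sub>1" "F\<^sub>1 \<le> 1" and F: "0 \<le> F" "F \<le> sqrt F\<^sub>1" "s * F \<le> F\<^sub>1"
    and quad: "F \<le> 1 - 2 * (1 - sqrt F\<^sub>1) + (1 - sqrt F\<^sub>1)\<^sup>2 / s"
  shows "F - F\<^sub>1 \<le> Delta_bar (1 - F) s"
proof -
  define q where "q = sqrt F\<^sub>1"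
  have q: "0 \<le> q" "q \<le> 1" "q\<^sup>2 = F\<^sub>1" "F \<le> q" using F1 F by (simp_all add: q_def)
  show ?thesis
  proof (cases "1 - F \<le> s")
    case True
    define l where "l = ell s (1 - F)"
    have F_le: "0 \<le> 1 - F" using q by simp
    note l = ell_properties[OF s(1) F_le True, folded l_def]
    have "1 - q \<le> l"
    proof (rule ccontr)
      assume "\<not> 1 - q \<le> l"
      \<comment> \<open>Both points lie left of the vertex \<open>s\<close>, where the parabola is
        strictly decreasing; its value at \<open>l\<close> is exactly \<open>F\<close>, against
        \<open>quad\<close>.\<close>
      then have lt: "l < 1 - q" "1 - q \<le> s" using True q by simp_all
      then have "(s - (1 - q))\<^sup>2 < (s - l)\<^sup>2" by (intro power_strict_mono) auto
      then have "(s - (1 - q))\<^sup>2 / s < (s - l)\<^sup>2 / s" using s by (simp add: divide_strict_right_mono)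
      moreover have "1 - 2 * t + t\<^sup>2 / s = (s - t)\<^sup>2 / s + 1 - s" for t
        using s by (simp add: power2_eq_square field_simps)
      ultimately show False
        using quad[folded q_def] l(2) by (smt (verit))
    qed
    moreover have "l \<le> s" by (rule l(1))
    ultimately have "(1 - l)\<^sup>2 \<le> q\<^sup>2" using s by (intro power_mono) auto
    moreover have "(1 / s - 1) * l\<^sup>2 = F - (1 - l)\<^sup>2"
      using l(2) by (simp add: power2_eq_square algebra_simps)
    ultimately show ?thesis using True by (simp add: Delta_bar_def l_def q)
  next
    case False
    have "F * F \<le> q * q" using q F by (intro mult_mono) auto
    then have "F * F \<le> F\<^sub>1" using q by (simp add: power2_eq_square)
    then have "F - F\<^sub>1 \<le> F * (1 - F)" by (simp add: algebra_simps)
    moreover have "F - F\<^sub>1 \<le> F * (1 - s)" using F(3) by (simp add: algebra_simps)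
    ultimately have "F - F\<^sub>1 \<le> F * min (1 - F) (1 - s)" by (simp add: min_def)
    then show ?thesis using False by (simp add: Delta_bar_def)
  qed
qed

section \<open>Passage from individual codes to the suprema\<close>

theorem corollary1:
  fixes \<rho> :: "complex ^ 'l ^ 'l"
    and N :: "complex ^ 'c ^ 'c \<Rightarrow> complex ^ 'c ^ 'c"
    and s :: real
  assumes "1 < CARD('l)" and "CARD('l) \<le> CARD('c)"
    and "state \<rho>"
    and "smallest_pos_eigenvalue \<rho> s" and "s \<in> {0<..1}"
    and "cptni N"
  shows "0 \<le> Delta_opt \<rho> N \<and> Delta_opt \<rho> N \<le> Delta_bar (eps_opt \<rho> N) s"
proof -
  obtain e p where "state_spectrum \<rho> s e p"
    using state_spectrum_exists[OF assms(3,4)] .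
  then interpret state_spectrum \<rho> s e p .
  have s: "0 < s" "s \<le> 1" using assms(5) by auto
  define S where "S = {ent_fidelity \<rho> (D \<circ> N \<circ> C) |
     (C :: complex ^ 'l ^ 'l \<Rightarrow> complex ^ 'c ^ 'c) (D :: complex ^ 'c ^ 'c \<Rightarrow> complex ^ 'l ^ 'l).
     cptni C \<and> cptni D}"
  define S\<^sub>1 where "S\<^sub>1 = {ent_fidelity \<rho> (D \<circ> N \<circ> C) |
     (C :: complex ^ 'l ^ 'l \<Rightarrow> complex ^ 'c ^ 'c) (D :: complex ^ 'c ^ 'c \<Rightarrow> complex ^ 'l ^ 'l).
     cptni C \<and> cptni D \<and> choi_rank C \<le> 1}"
  define F where "F = F_opt \<rho> N"
  define F\<^sub>1 where "F\<^sub>1 = F_opt1 \<rho> N"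
  have F_Sup: "F = Sup S" "F\<^sub>1 = Sup S\<^sub>1"
    by (simp_all add: F_def F\<^sub>1_def F_opt_def F_opt1_def S_def S\<^sub>1_def)
  have sub: "S\<^sub>1 \<subseteq> S" by (auto simp: S_def S\<^sub>1_def)
  have codes: "\<exists>x y z. y \<in> S\<^sub>1 \<and> z \<in> S\<^sub>1 \<and> 0 \<le> x \<and> g \<le> 1 - x \<and> g \<le> 1 - 2 * x + x\<^sup>2 / s \<and>
      (1 - x)\<^sup>2 \<le> y \<and> s * g \<le> z" if g: "g \<in> S" "0 < g" for g
  proof -
    obtain C :: "complex ^ 'l ^ 'l \<Rightarrow> complex ^ 'c ^ 'c" and D
      where "cptni C" and D: "cptni D" and "g = ent_fidelity \<rho> (D \<circ> N \<circ> C)"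
      using g by (auto simp: S_def)
    from rank_one_codes[OF this(1,2) assms(6) this(3) g(2)] obtain C\<^sub>1 C\<^sub>2 :: "complex ^ 'l ^ 'l \<Rightarrow> complex ^ 'c ^ 'c" and x
      where C: "cptni C\<^sub>1" "choi_rank C\<^sub>1 \<le> 1" "cptni C\<^sub>2" "choi_rank C\<^sub>2 \<le> 1"
      and x: "0 \<le> x" "g \<le> 1 - x" "g \<le> 1 - 2 * x + x\<^sup>2 / s"
        "(1 - x)\<^sup>2 \<le> ent_fidelity \<rho> (D \<circ> N \<circ> C\<^sub>1)" "s * g \<le> ent_fidelity \<rho> (D \<circ> N \<circ> C\<^sub>2)" .
    have "ent_fidelity \<rho> (D \<circ> N \<circ> C\<^sub>1) \<in> S\<^sub>1" "ent_fidelity \<rho> (D \<circ> N \<circ> C\<^sub>2) \<in> S\<^sub>1"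
      using C D unfolding S\<^sub>1_def by blast+
    with x show ?thesis by blast
  qed
  \<comment> \<open>The bound \<open>g \<le> 1 - x\<close> with \<open>0 \<le> x\<close> also
    supplies the boundedness that the suprema require.\<close>
  have S_le: "g \<le> 1" if "g \<in> S" for g
    using codes[OF that] by (cases "0 < g") auto
  have bdd: "bdd_above S" "bdd_above S\<^sub>1"
    using S_le sub by (auto intro!: bdd_aboveI[of _ 1])
  have S_nonneg: "0 \<le> g" if "g \<in> S" for g
    using that ent_fidelity_nonneg[OF _ _ assms(6)] by (auto simp: S_def)
  \<comment> \<open>The zero operator serves as encoder and as decoder, so both sets of fidelities
    are nonempty.\<close>
  have "contractive 0" by (simp add: contractive_def)
  from cptni_conj[OF this] cptni_conj(1)[OF this] have ne: "S\<^sub>1 \<noteq> {}"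
    unfolding S\<^sub>1_def by blast
  then have ne': "S \<noteq> {}" using sub by blast
  have F1_ge: "y \<le> F\<^sub>1" if "y \<in> S\<^sub>1" for y
    unfolding F_Sup using that bdd by (intro cSup_upper)
  obtain y\<^sub>0 where "y\<^sub>0 \<in> S\<^sub>1" using ne by blast
  then have F1_0: "0 \<le> F\<^sub>1" using F1_ge S_nonneg sub by (meson order_trans subsetD)
  have F1_F: "F\<^sub>1 \<le> F" unfolding F_Sup using ne bdd sub by (intro cSup_subset_mono)
  have F_1: "F \<le> 1" unfolding F_Sup using ne' S_le by (rule cSup_least)
  define q where "q = sqrt F\<^sub>1"
  have q: "0 \<le> q" using F1_0 by (simp add: q_def)
  \<comment> \<open>Each code has its own \<open>x\<close>; it is replaced by the common value
    \<open>1 - q\<close>, so that the inequalities bound \<open>g\<close> uniformly and pass to the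
    supremum.\<close>
  have bounds: "g \<le> q \<and> s * g \<le> F\<^sub>1 \<and> g \<le> 1 - 2 * (1 - q) + (1 - q)\<^sup>2 / s" if "g \<in> S" for g
  proof -
    have quad: "1 - s \<le> 1 - 2 * t + t\<^sup>2 / s" for t
      using s zero_le_power2[of "s - t"] by (simp add: power2_eq_square field_simps)
    show ?thesis
    proof (cases "0 < g")
      case True
      obtain x y z where "y \<in> S\<^sub>1" "z \<in> S\<^sub>1" and x: "0 \<le> x" "g \<le> 1 - x" "g \<le> 1 - 2 * x + x\<^sup>2 / s"
        and y: "(1 - x)\<^sup>2 \<le> y" and z: "s * g \<le> z"
        using codes[OF \<open>g \<in> S\<close> True] by blast
      then have "(1 - x)\<^sup>2 \<le> F\<^sub>1" "s * g \<le> F\<^sub>1" using F1_ge by force+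
      then have "1 - x \<le> q" unfolding q_def by (intro real_le_rsqrt)
      moreover have "g \<le> 1 - 2 * (1 - q) + (1 - q)\<^sup>2 / s"
      \<comment> \<open>For \<open>x \<le> s\<close> monotonicity applies to
        \<open>1 - q \<le> x\<close>. Otherwise \<open>g \<le> 1 - x < 1 - s\<close>, which is below
        the minimum of the parabola.\<close>
      proof (cases "x \<le> s")
        case True
        then show ?thesis
          using quadratic_deficit_antimono[OF s(1), of "1 - q" x] x \<open>1 - x \<le> q\<close> by simp
      next
        case False
        then show ?thesis using x(2) quad[of "1 - q"] by simp
      qed
      ultimately show ?thesis using x \<open>s * g \<le> F\<^sub>1\<close> by simp
    next
      case False
      then have "g = 0" using S_nonneg[OF \<open>g \<in> S\<close>] by simp
      then show ?thesis using q F1_0 quad[of "1 - q"] s by simp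
    qed
  qed
  have "F - F\<^sub>1 \<le> Delta_bar (1 - F) s"
  proof (rule Delta_bar_bound[OF s F1_0])
    show "F \<le> sqrt F\<^sub>1" "F \<le> 1 - 2 * (1 - sqrt F\<^sub>1) + (1 - sqrt F\<^sub>1)\<^sup>2 / s"
      unfolding q_def[symmetric] F_Sup(1) using ne' bounds by (auto intro!: cSup_least)
    have "F \<le> F\<^sub>1 / s"
      unfolding F_Sup(1) using ne' bounds s by (intro cSup_least) (auto simp: pos_le_divide_eq mult.commute)
    then show "s * F \<le> F\<^sub>1" using s by (simp add: pos_le_divide_eq mult.commute)
  qed (use F1_0 F1_F F_1 in auto)
  then show ?thesis using F1_F by (simp add: Delta_opt_def eps_opt_def F_def F\<^sub>1_def)
qed

end
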